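(* Let $\mathfrak{g}$ be a finite dimensional Lie algebra over $\mathbb{C}$ and let $V$ be a right $\mathfrak{g}$-module (action $v\cdot X$) which is also a right $S(\mathfrak{g}^* )$-module (action $v\lhd\theta$). Then the graded space $(W^\bullet(\mathfrak{g},V),\,d_{\rm CE}+d_{\rm K})$ is a complex, i.e. $(d_{\rm CE}+d_{\rm K})^2=0$, if and only if $V$ is a unimodular stable right $\widetilde{\mathfrak{g}}$-module.
   Context: Let $X_1,\dots,X_N$ and $\theta^1,\dots,\theta^N$ be dual bases of $\mathfrak{g}$ and $\mathfrak{g}^*$, with $[X_j,X_k]=\sum_iC^i_{jk}X_i$. Set $W^n(\mathfrak{g},V)=\wedge^n\mathfrak{g}^*\otimes V$, $n\ge0$, with $$d_{\rm CE}(\beta\otimes v)=d_{\rm dR}(\beta)\otimes v-\sum_i\theta^i\wedge\beta\otimes v\cdot X_i,\qquad d_{\rm K}(\alpha\otimes v)=\sum_i\iota_{X_i}(\alpha)\otimes v\lhd\theta^i,$$ where $d_{\rm dR}$ is the degree $+1$ derivation of $\wedge\mathfrak{g}^*$ with $d_{\rm dR}(\theta^i)=-\frac12\sum_{j,k}C^i_{jk}\theta^j\wedge\theta^k$ and $\iota_X$ is contraction. $\widetilde{\mathfrak{g}}=\mathfrak{g}^*\rtimes\mathfrak{g}$ is the vector space $\mathfrak{g}^*\oplus\mathfrak{g}$ with bracket $[\alpha\oplus X,\beta\oplus Y]=(\mathcal{L}_X\beta-\mathcal{L}_Y\alpha)\oplus[X,Y]$, where $\mathcal{L}$ is the coadjoint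 action, $\mathcal{L}_{X_j}\theta^t=X_j\rhd\theta^t=-\sum_kC^t_{jk}\theta^k$. That $V$, with the two given actions, is a right $\widetilde{\mathfrak{g}}$-module means $(v\cdot X_j)\lhd\theta^t=v\lhd(X_j\rhd\theta^t)+(v\lhd\theta^t)\cdot X_j$ for all $v\in V$ and all $j,t$. It is unimodular stable if $\sum_k(v\cdot X_k)\lhd\theta^k=0$ for all $v\in V$. *)

theory Defs
  imports Complex_Main "HOL-Library.Function_Algebras" "HOL-Library.Product_Plus"
begin

section \<open>Lie algebras, dual bases, modules\<close>

text \<open>Scalar multiplications are passed explicitly, as in \<^theory>\<open>HOL.Vector_Spaces\<close>. A Lie algebra
  occupies its whole type; the dual of \<open>'g\<close> consists of the functions \<open>'g \<Rightarrow> complex\<close> that are linear,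
  and addition of functions is the pointwise one from \<^theory>\<open>HOL-Library.Function_Algebras\<close>.\<close>

locale complex_lie_algebra = vector_space sg
  for sg :: "complex \<Rightarrow> 'g::ab_group_add \<Rightarrow> 'g" +
  fixes br :: "'g \<Rightarrow> 'g \<Rightarrow> 'g"
  assumes linear_right: "Vector_Spaces.linear sg sg (br x)"
    and linear_left: "Vector_Spaces.linear sg sg (\<lambda>x. br x y)"
    and alternating: "br x x = 0"
    and jacobi: "br x (br y z) + br y (br z x) + br z (br x y) = 0"

definition dual_space :: "(complex \<Rightarrow> 'g::ab_group_add \<Rightarrow> 'g) \<Rightarrow> ('g \<Rightarrow> complex) set" where
  "dual_space sg = {\<alpha>. Vector_Spaces.linear sg (*) \<alpha>}"

locale dual_bases = vector_space sg
  for sg :: "complex \<Rightarrow> 'g::ab_group_add \<Rightarrow> 'g" +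
  fixes N :: nat and X :: "nat \<Rightarrow> 'g" and \<theta> :: "nat \<Rightarrow> 'g \<Rightarrow> complex"
  assumes basis_inj: "inj_on X {1..N}"
    and basis_independent: "independent (X ` {1..N})"
    and basis_span: "span (X ` {1..N}) = UNIV"
    and dual_mem: "i \<in> {1..N} \<Longrightarrow> \<theta> i \<in> dual_space sg"
    and dual_pairing: "i \<in> {1..N} \<Longrightarrow> j \<in> {1..N} \<Longrightarrow> \<theta> i (X j) = (if i = j then 1 else 0)"

text \<open>The defining property \<open>[X j, X k] = (\<Sum>i. C i j k * X i)\<close> is \<open>bracket_basis\<close> below.\<close>

definition struct_const :: "('g \<Rightarrow> 'g \<Rightarrow> 'g) \<Rightarrow> (nat \<Rightarrow> 'g) \<Rightarrow> (nat \<Rightarrow> 'g \<Rightarrow> complex) \<Rightarrow>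
    nat \<Rightarrow> nat \<Rightarrow> nat \<Rightarrow> complex" where
  "struct_const br X \<theta> i j k = \<theta> i (br (X j) (X k))"

text \<open>A right module \<open>V\<close> over the Lie algebra with underlying space \<open>L\<close>, a subspace of the ambient type.
  The whole type \<open>'v\<close> is \<open>V\<close>.\<close>

definition right_lie_module :: "'l::ab_group_add set \<Rightarrow> (complex \<Rightarrow> 'l \<Rightarrow> 'l) \<Rightarrow> ('l \<Rightarrow> 'l \<Rightarrow> 'l) \<Rightarrow>
    (complex \<Rightarrow> 'v::ab_group_add \<Rightarrow> 'v) \<Rightarrow> ('v \<Rightarrow> 'l \<Rightarrow> 'v) \<Rightarrow> bool" where
  "right_lie_module L sl brl sv act \<longleftrightarrow> vector_space sv \<and>
     (\<forall>x\<in>L. Vector_Spaces.linear sv sv (\<lambda>v. act v x)) \<and>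
     (\<forall>v. \<forall>x\<in>L. \<forall>y\<in>L. act v (x + y) = act v x + act v y) \<and>
     (\<forall>v c. \<forall>x\<in>L. act v (sl c x) = sv c (act v x)) \<and>
     (\<forall>v. \<forall>x\<in>L. \<forall>y\<in>L. act v (brl x y) = act (act v x) y - act (act v y) x)"

text \<open>As \<open>\<complex>\<close> is infinite, the symmetric algebra \<open>S(\<gg>*)\<close> is the algebra of polynomial functions on \<open>\<gg>\<close>,
  i.e. the algebra of functions generated by \<open>\<gg>*\<close>. So \<open>\<gg>*\<close> is literally a subset of it.\<close>

inductive_set sym_algebra :: "(complex \<Rightarrow> 'g::ab_group_add \<Rightarrow> 'g) \<Rightarrow> ('g \<Rightarrow> complex) set"
  for sg :: "complex \<Rightarrow> 'g::ab_group_add \<Rightarrow> 'g" where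
  const: "(\<lambda>_. c) \<in> sym_algebra sg"
| dual: "\<alpha> \<in> dual_space sg \<Longrightarrow> \<alpha> \<in> sym_algebra sg"
| add: "p \<in> sym_algebra sg \<Longrightarrow> q \<in> sym_algebra sg \<Longrightarrow> p + q \<in> sym_algebra sg"
| mult: "p \<in> sym_algebra sg \<Longrightarrow> q \<in> sym_algebra sg \<Longrightarrow> p * q \<in> sym_algebra sg"

definition right_sym_module :: "(complex \<Rightarrow> 'g::ab_group_add \<Rightarrow> 'g) \<Rightarrow>
    (complex \<Rightarrow> 'v::ab_group_add \<Rightarrow> 'v) \<Rightarrow> ('v \<Rightarrow> ('g \<Rightarrow> complex) \<Rightarrow> 'v) \<Rightarrow> bool" where
  "right_sym_module sg sv acts \<longleftrightarrow> vector_space sv \<and>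
     (\<forall>p\<in>sym_algebra sg. Vector_Spaces.linear sv sv (\<lambda>v. acts v p)) \<and>
     (\<forall>v. \<forall>p\<in>sym_algebra sg. \<forall>q\<in>sym_algebra sg. acts v (p + q) = acts v p + acts v q) \<and>
     (\<forall>v c. acts v (\<lambda>_. c) = sv c v) \<and>
     (\<forall>v. \<forall>p\<in>sym_algebra sg. \<forall>q\<in>sym_algebra sg. acts v (p * q) = acts (acts v p) q)"


section \<open>The semidirect product \<open>\<gg>* \<rtimes> \<gg>\<close>\<close>

definition coad :: "('g \<Rightarrow> 'g \<Rightarrow> 'g) \<Rightarrow> 'g \<Rightarrow> ('g \<Rightarrow> complex) \<Rightarrow> 'g \<Rightarrow> complex" where
  "coad br x \<beta> = (\<lambda>y. - \<beta> (br x y))"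

definition sd_carrier :: "(complex \<Rightarrow> 'g::ab_group_add \<Rightarrow> 'g) \<Rightarrow> (('g \<Rightarrow> complex) \<times> 'g) set" where
  "sd_carrier sg = dual_space sg \<times> UNIV"

definition sd_scale :: "(complex \<Rightarrow> 'g \<Rightarrow> 'g) \<Rightarrow> complex \<Rightarrow>
    ('g \<Rightarrow> complex) \<times> 'g \<Rightarrow> ('g \<Rightarrow> complex) \<times> 'g" where
  "sd_scale sg c = (\<lambda>(\<alpha>, x). (\<lambda>y. c * \<alpha> y, sg c x))"

definition sd_bracket :: "('g \<Rightarrow> 'g \<Rightarrow> 'g) \<Rightarrow>
    ('g \<Rightarrow> complex) \<times> 'g \<Rightarrow> ('g \<Rightarrow> complex) \<times> 'g \<Rightarrow> ('g \<Rightarrow> complex) \<times> 'g" where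
  "sd_bracket br = (\<lambda>(\<alpha>, x) (\<beta>, y). (coad br x \<beta> - coad br y \<alpha>, br x y))"

definition sd_act :: "('v::plus \<Rightarrow> 'g \<Rightarrow> 'v) \<Rightarrow> ('v \<Rightarrow> ('g \<Rightarrow> complex) \<Rightarrow> 'v) \<Rightarrow>
    'v \<Rightarrow> ('g \<Rightarrow> complex) \<times> 'g \<Rightarrow> 'v" where
  "sd_act act acts v = (\<lambda>(\<alpha>, x). acts v \<alpha> + act v x)"

text \<open>Equivalently, \<open>(v \<cdot> X j) \<lhd> \<theta> t = v \<lhd> (X j \<rhd> \<theta> t) + (v \<lhd> \<theta> t) \<cdot> X j\<close> for all \<open>v\<close>, \<open>j\<close>, \<open>t\<close>:
  see \<open>right_sd_module_iff\<close> below, and \<open>coad_basis\<close> for the coadjoint action in coordinates.\<close>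

definition right_sd_module :: "(complex \<Rightarrow> 'g::ab_group_add \<Rightarrow> 'g) \<Rightarrow> ('g \<Rightarrow> 'g \<Rightarrow> 'g) \<Rightarrow>
    (complex \<Rightarrow> 'v::ab_group_add \<Rightarrow> 'v) \<Rightarrow> ('v \<Rightarrow> 'g \<Rightarrow> 'v) \<Rightarrow> ('v \<Rightarrow> ('g \<Rightarrow> complex) \<Rightarrow> 'v) \<Rightarrow> bool" where
  "right_sd_module sg br sv act acts \<longleftrightarrow>
     right_lie_module (sd_carrier sg) (sd_scale sg) (sd_bracket br) sv (sd_act act acts)"

definition unimodular_stable :: "nat \<Rightarrow> (nat \<Rightarrow> 'g) \<Rightarrow> (nat \<Rightarrow> 'g \<Rightarrow> complex) \<Rightarrow>
    ('v::ab_group_add \<Rightarrow> 'g \<Rightarrow> 'v) \<Rightarrow> ('v \<Rightarrow> ('g \<Rightarrow> complex) \<Rightarrow> 'v) \<Rightarrow> bool" where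
  "unimodular_stable N X \<theta> act acts \<longleftrightarrow> (\<forall>v. (\<Sum>k=1..N. acts (act v (X k)) (\<theta> k)) = 0)"


section \<open>The exterior algebra of \<open>\<gg>*\<close> and \<open>W(\<gg>,V)\<close>\<close>

text \<open>For \<open>S = {s1 < ... < sp} \<subseteq> {1..N}\<close> let \<open>\<theta>_S = \<theta> s1 \<and> ... \<and> \<theta> sp\<close>; these monomials form a basis
  of the exterior algebra of \<open>\<gg>*\<close>. The element \<open>\<Sum>S. \<theta>_S \<otimes> w S\<close> of \<open>\<And>\<gg>* \<otimes> V\<close> is represented by the
  function \<open>w\<close>, and \<open>V = \<complex>\<close> gives \<open>\<And>\<gg>*\<close> itself. \<open>W N\<close> is the direct sum of the \<open>W_deg N n\<close>.\<close>

definition W :: "nat \<Rightarrow> (nat set \<Rightarrow> 'v::zero) set" where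
  "W N = {w. \<forall>S. w S \<noteq> 0 \<longrightarrow> S \<subseteq> {1..N}}"

definition W_deg :: "nat \<Rightarrow> nat \<Rightarrow> (nat set \<Rightarrow> 'v::zero) set" where
  "W_deg N n = {w. \<forall>S. w S \<noteq> 0 \<longrightarrow> S \<subseteq> {1..N} \<and> card S = n}"

definition mono_form :: "nat set \<Rightarrow> nat set \<Rightarrow> complex" where
  "mono_form S = (\<lambda>T. if T = S then 1 else 0)"

abbreviation gen :: "nat \<Rightarrow> nat set \<Rightarrow> complex" where
  "gen i \<equiv> mono_form {i}"

definition escale :: "complex \<Rightarrow> (nat set \<Rightarrow> complex) \<Rightarrow> nat set \<Rightarrow> complex" where
  "escale c \<alpha> = (\<lambda>S. c * \<alpha> S)"

text \<open>For disjoint \<open>S\<close> and \<open>T\<close> one has \<open>\<theta>_S \<and> \<theta>_T = shuffle_sign S T * \<theta>_(S \<union> T)\<close>; see \<open>mono_form_wedge\<close>.\<close>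

definition shuffle_sign :: "nat set \<Rightarrow> nat set \<Rightarrow> complex" where
  "shuffle_sign S T = (-1) ^ card {(s, t). s \<in> S \<and> t \<in> T \<and> t < s}"

definition wedge :: "(nat set \<Rightarrow> complex) \<Rightarrow> (nat set \<Rightarrow> complex) \<Rightarrow> nat set \<Rightarrow> complex"
    (infixl "\<^bold>\<and>" 70) where
  "\<alpha> \<^bold>\<and> \<beta> = (\<lambda>U. \<Sum>S\<in>Pow U. shuffle_sign S (U - S) * \<alpha> S * \<beta> (U - S))"

text \<open>Contraction sends \<open>\<theta>_S\<close> to \<open>\<Sum>k. (-1)^(k-1) * \<theta> sk x * \<theta>_(S - {sk})\<close>, where \<open>(-1)^(k-1)\<close> is
  \<open>shuffle_sign {sk} (S - {sk})\<close>. It is characterised by \<open>contract_gen\<close> and \<open>contract_antiderivation\<close>.\<close>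

definition contract :: "nat \<Rightarrow> (nat \<Rightarrow> 'g \<Rightarrow> complex) \<Rightarrow> 'g \<Rightarrow> (nat set \<Rightarrow> complex) \<Rightarrow> nat set \<Rightarrow> complex" where
  "contract N \<theta> x \<beta> = (\<lambda>T. \<Sum>i\<in>{1..N} - T. \<theta> i x * shuffle_sign {i} T * \<beta> (insert i T))"

definition is_dR :: "nat \<Rightarrow> (nat \<Rightarrow> nat \<Rightarrow> nat \<Rightarrow> complex) \<Rightarrow>
    ((nat set \<Rightarrow> complex) \<Rightarrow> nat set \<Rightarrow> complex) \<Rightarrow> bool" where
  "is_dR N C d \<longleftrightarrow>
     (\<forall>\<alpha>\<in>W N. \<forall>\<beta>\<in>W N. d (\<alpha> + \<beta>) = d \<alpha> + d \<beta>) \<and>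
     (\<forall>c. \<forall>\<alpha>\<in>W N. d (escale c \<alpha>) = escale c (d \<alpha>)) \<and>
     (\<forall>p. \<forall>\<alpha>\<in>W_deg N p. d \<alpha> \<in> W_deg N (p + 1)) \<and>
     (\<forall>p. \<forall>\<alpha>\<in>W_deg N p. \<forall>\<beta>\<in>W N. d (\<alpha> \<^bold>\<and> \<beta>) = d \<alpha> \<^bold>\<and> \<beta> + escale ((-1) ^ p) (\<alpha> \<^bold>\<and> d \<beta>)) \<and>
     (\<forall>i\<in>{1..N}. d (gen i) = escale (- 1 / 2) (\<Sum>j=1..N. \<Sum>k=1..N. escale (C i j k) (gen j \<^bold>\<and> gen k)))"

text \<open>The value \<open>0\<close> outside \<open>\<And>\<gg>*\<close> only makes the function unique; see \<open>dR_unique\<close> below.\<close>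

definition dR :: "nat \<Rightarrow> (nat \<Rightarrow> nat \<Rightarrow> nat \<Rightarrow> complex) \<Rightarrow> (nat set \<Rightarrow> complex) \<Rightarrow> nat set \<Rightarrow> complex" where
  "dR N C = (THE d. is_dR N C d \<and> (\<forall>\<beta>. \<beta> \<notin> W N \<longrightarrow> d \<beta> = 0))"

definition tensor :: "(complex \<Rightarrow> 'v \<Rightarrow> 'v) \<Rightarrow> (nat set \<Rightarrow> complex) \<Rightarrow> 'v \<Rightarrow> nat set \<Rightarrow> 'v" where
  "tensor sv \<beta> v = (\<lambda>S. sv (\<beta> S) v)"

text \<open>The linear map on \<open>\<And>\<gg>* \<otimes> V\<close> that sends \<open>\<beta> \<otimes> v\<close> to \<open>f \<beta> v\<close>, for bilinear \<open>f\<close>. That the two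
  differentials take the intended values on all \<open>\<beta> \<otimes> v\<close> is \<open>d_CE_tensor\<close> and \<open>d_K_tensor\<close>.\<close>

definition tensor_lift :: "nat \<Rightarrow> ((nat set \<Rightarrow> complex) \<Rightarrow> 'v \<Rightarrow> 'w::comm_monoid_add) \<Rightarrow> (nat set \<Rightarrow> 'v) \<Rightarrow> 'w" where
  "tensor_lift N f w = (\<Sum>S\<in>Pow {1..N}. f (mono_form S) (w S))"

definition d_CE :: "('g \<Rightarrow> 'g \<Rightarrow> 'g) \<Rightarrow> nat \<Rightarrow> (nat \<Rightarrow> 'g) \<Rightarrow> (nat \<Rightarrow> 'g \<Rightarrow> complex) \<Rightarrow>
    (complex \<Rightarrow> 'v::ab_group_add \<Rightarrow> 'v) \<Rightarrow> ('v \<Rightarrow> 'g \<Rightarrow> 'v) \<Rightarrow> (nat set \<Rightarrow> 'v) \<Rightarrow> nat set \<Rightarrow> 'v" where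
  "d_CE br N X \<theta> sv act = tensor_lift N (\<lambda>\<beta> v.
     tensor sv (dR N (struct_const br X \<theta>) \<beta>) v - (\<Sum>i=1..N. tensor sv (gen i \<^bold>\<and> \<beta>) (act v (X i))))"

definition d_K :: "nat \<Rightarrow> (nat \<Rightarrow> 'g) \<Rightarrow> (nat \<Rightarrow> 'g \<Rightarrow> complex) \<Rightarrow>
    (complex \<Rightarrow> 'v::ab_group_add \<Rightarrow> 'v) \<Rightarrow> ('v \<Rightarrow> ('g \<Rightarrow> complex) \<Rightarrow> 'v) \<Rightarrow> (nat set \<Rightarrow> 'v) \<Rightarrow> nat set \<Rightarrow> 'v" where
  "d_K N X \<theta> sv acts = tensor_lift N (\<lambda>\<alpha> v.
     \<Sum>i=1..N. tensor sv (contract N \<theta> (X i) \<alpha>) (acts v (\<theta> i)))"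

definition d_total :: "('g \<Rightarrow> 'g \<Rightarrow> 'g) \<Rightarrow> nat \<Rightarrow> (nat \<Rightarrow> 'g) \<Rightarrow> (nat \<Rightarrow> 'g \<Rightarrow> complex) \<Rightarrow>
    (complex \<Rightarrow> 'v::ab_group_add \<Rightarrow> 'v) \<Rightarrow> ('v \<Rightarrow> 'g \<Rightarrow> 'v) \<Rightarrow> ('v \<Rightarrow> ('g \<Rightarrow> complex) \<Rightarrow> 'v) \<Rightarrow>
    (nat set \<Rightarrow> 'v) \<Rightarrow> nat set \<Rightarrow> 'v" where
  "d_total br N X \<theta> sv act acts w = d_CE br N X \<theta> sv act w + d_K N X \<theta> sv acts w"

section \<open>Basic facts justifying the definitions\<close>

lemma sum_fun_apply: "(\<Sum>i\<in>A. f i) x = (\<Sum>i\<in>A. f i x)"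
  by (induction A rule: infinite_finite_induct) auto

lemma shuffle_sign_empty [simp]: "shuffle_sign {} T = 1" "shuffle_sign S {} = 1"
  by (simp_all add: shuffle_sign_def)

lemma finite_inversions: "finite S \<Longrightarrow> finite T \<Longrightarrow> finite {(s, t). s \<in> S \<and> t \<in> T \<and> t < (s::nat)}"
  by (rule finite_subset[of _ "S \<times> T"]) auto

lemma shuffle_sign_Un_left:
  assumes "finite S" "finite T" "finite R" "S \<inter> T = {}"
  shows "shuffle_sign (S \<union> T) R = shuffle_sign S R * shuffle_sign T R"
proof -
  have "{(s, t). s \<in> S \<union> T \<and> t \<in> R \<and> t < s} =
      {(s, t). s \<in> S \<and> t \<in> R \<and> t < s} \<union> {(s, t). s \<in> T \<and> t \<in> R \<and> t < s}" by auto
  moreover have "card \<dots> = card {(s, t). s \<in> S \<and> t \<in> R \<and> t < s} + card {(s, t). s \<in> T \<and> t \<in> R \<and> t < s}"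
    using assms by (intro card_Un_disjoint finite_inversions) auto
  ultimately show ?thesis by (simp add: shuffle_sign_def power_add)
qed

lemma shuffle_sign_Un_right:
  assumes "finite S" "finite T" "finite R" "S \<inter> T = {}"
  shows "shuffle_sign R (S \<union> T) = shuffle_sign R S * shuffle_sign R T"
proof -
  have "{(s, t). s \<in> R \<and> t \<in> S \<union> T \<and> t < s} =
      {(s, t). s \<in> R \<and> t \<in> S \<and> t < s} \<union> {(s, t). s \<in> R \<and> t \<in> T \<and> t < s}" by auto
  moreover have "card \<dots> = card {(s, t). s \<in> R \<and> t \<in> S \<and> t < s} + card {(s, t). s \<in> R \<and> t \<in> T \<and> t < s}"
    using assms by (intro card_Un_disjoint finite_inversions) auto
  ultimately show ?thesis by (simp add: shuffle_sign_def power_add)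
qed

lemma shuffle_sign_swap:
  assumes "finite S" "finite T" "S \<inter> T = {}"
  shows "shuffle_sign S T * shuffle_sign T S = (-1) ^ (card S * card T)"
proof -
  let ?A = "{(s, t). s \<in> S \<and> t \<in> T \<and> t < s}" and ?B = "{(s, t). s \<in> T \<and> t \<in> S \<and> t < s}"
  have "card S * card T = card (S \<times> T)" by (simp add: card_cartesian_product)
  also have "S \<times> T = ?A \<union> prod.swap ` ?B"
    using assms(3) by (auto simp: image_iff) (metis disjoint_iff linorder_neqE_nat)?
  also have "card \<dots> = card ?A + card (prod.swap ` ?B)"
    using assms by (intro card_Un_disjoint finite_inversions finite_imageI) auto
  also have "card (prod.swap ` ?B) = card ?B" by (rule card_image) (simp add: inj_on_def)
  finally show ?thesis by (simp add: shuffle_sign_def power_add)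
qed

lemma shuffle_sign_square [simp]: "shuffle_sign S T * shuffle_sign S T = 1"
  by (simp add: shuffle_sign_def flip: power_mult_distrib)

lemma wedge_infinite: "infinite U \<Longrightarrow> (\<alpha> \<^bold>\<and> \<beta>) U = 0"
  by (simp add: wedge_def)

lemma wedge_add_left: "(\<alpha> + \<alpha>') \<^bold>\<and> \<beta> = \<alpha> \<^bold>\<and> \<beta> + \<alpha>' \<^bold>\<and> \<beta>"
  by (rule ext) (simp add: wedge_def algebra_simps sum.distrib)
lemma wedge_add_right: "\<alpha> \<^bold>\<and> (\<beta> + \<beta>') = \<alpha> \<^bold>\<and> \<beta> + \<alpha> \<^bold>\<and> \<beta>'"
  by (rule ext) (simp add: wedge_def algebra_simps sum.distrib)
lemma wedge_escale_left: "escale c \<alpha> \<^bold>\<and> \<beta> = escale c (\<alpha> \<^bold>\<and> \<beta>)"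
  by (rule ext) (simp add: wedge_def escale_def sum_distrib_left mult_ac)
lemma wedge_escale_right: "\<alpha> \<^bold>\<and> escale c \<beta> = escale c (\<alpha> \<^bold>\<and> \<beta>)"
  by (rule ext) (simp add: wedge_def escale_def sum_distrib_left mult_ac)
lemma wedge_zero_left: "0 \<^bold>\<and> \<beta> = 0"
  by (rule ext) (simp add: wedge_def)
lemma wedge_zero_right: "\<beta> \<^bold>\<and> 0 = 0"
  by (rule ext) (simp add: wedge_def)
lemma wedge_sum_left: "(\<Sum>i\<in>A. f i) \<^bold>\<and> \<beta> = (\<Sum>i\<in>A. f i \<^bold>\<and> \<beta>)"
  by (induction A rule: infinite_finite_induct) (simp_all only: sum.infinite sum.empty sum.insert wedge_add_left wedge_zero_left not_False_eq_True simp_thms)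
lemma wedge_sum_right: "\<beta> \<^bold>\<and> (\<Sum>i\<in>A. f i) = (\<Sum>i\<in>A. \<beta> \<^bold>\<and> f i)"
  by (induction A rule: infinite_finite_induct) (simp_all only: sum.infinite sum.empty sum.insert wedge_add_right wedge_zero_right not_False_eq_True simp_thms)

lemma escale_apply: "escale c \<alpha> S = c * \<alpha> S"
  by (simp add: escale_def)
lemma escale_add: "escale c (\<alpha> + \<beta>) = escale c \<alpha> + escale c \<beta>"
  by (rule ext) (simp add: escale_def algebra_simps)
lemma escale_zero: "escale c 0 = 0"
  by (rule ext) (simp add: escale_def)
lemma escale_sum: "escale c (\<Sum>i\<in>A. f i) = (\<Sum>i\<in>A. escale c (f i))"
  by (induction A rule: infinite_finite_induct) (simp_all only: sum.infinite sum.empty sum.insert escale_add escale_zero not_False_eq_True simp_thms)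

lemma wedge_assoc: "(\<alpha> \<^bold>\<and> \<beta>) \<^bold>\<and> \<gamma> = \<alpha> \<^bold>\<and> (\<beta> \<^bold>\<and> \<gamma>)"
proof (rule ext)
  fix U :: "nat set"
  show "((\<alpha> \<^bold>\<and> \<beta>) \<^bold>\<and> \<gamma>) U = (\<alpha> \<^bold>\<and> (\<beta> \<^bold>\<and> \<gamma>)) U"
  proof (cases "finite U")
    case fin: True
    have fs: "finite S" if "S \<subseteq> U" for S using that fin finite_subset by blast
    have "((\<alpha> \<^bold>\<and> \<beta>) \<^bold>\<and> \<gamma>) U = (\<Sum>A\<in>Pow U. \<Sum>S\<in>Pow A. shuffle_sign A (U - A) *
        (shuffle_sign S (A - S) * \<alpha> S * \<beta> (A - S)) * \<gamma> (U - A))"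
      by (simp add: wedge_def sum_distrib_left sum_distrib_right)
    also have "\<dots> = (\<Sum>(A, S)\<in>(SIGMA A:Pow U. Pow A). shuffle_sign A (U - A) *
        (shuffle_sign S (A - S) * \<alpha> S * \<beta> (A - S)) * \<gamma> (U - A))"
      using fin fs by (intro sum.Sigma) auto
    also have "\<dots> = (\<Sum>(S, T)\<in>(SIGMA S:Pow U. Pow (U - S)). shuffle_sign S (U - S) * \<alpha> S *
        (shuffle_sign T (U - S - T) * \<beta> T * \<gamma> (U - S - T)))"
    proof (rule sum.reindex_bij_witness[of _ "\<lambda>(S, T). (S \<union> T, S)" "\<lambda>(A, S). (S, A - S)"], goal_cases)
      case (5 p)
      obtain A S where p: "p = (A, S)" "A \<subseteq> U" "S \<subseteq> A" using 5 by auto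
      define T R where "T = A - S" and "R = U - A"
      have eq: "A = S \<union> T" "U - S = T \<union> R" "U - S - T = R" "A - S = T" "U - A = R"
        using p by (auto simp: T_def R_def)
      have disj: "S \<inter> T = {}" "T \<inter> R = {}" by (auto simp: T_def R_def)
      have f: "finite S" "finite T" "finite R" using p fin by (auto simp: T_def R_def intro: fs)
      have sl: "shuffle_sign (S \<union> T) R = shuffle_sign S R * shuffle_sign T R"
        and sr: "shuffle_sign S (T \<union> R) = shuffle_sign S T * shuffle_sign S R"
        by (rule shuffle_sign_Un_left shuffle_sign_Un_right, use f disj in auto)+
      show ?case unfolding p(1) prod.case eq(4,5) unfolding eq(3) unfolding eq(1,2) sl sr eq(4)
        by (simp only: mult_ac)
    qed auto
    also have "\<dots> = (\<Sum>S\<in>Pow U. \<Sum>T\<in>Pow (U - S). shuffle_sign S (U - S) * \<alpha> S *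
        (shuffle_sign T (U - S - T) * \<beta> T * \<gamma> (U - S - T)))"
      using fin fs by (intro sum.Sigma[symmetric]) auto
    also have "\<dots> = (\<alpha> \<^bold>\<and> (\<beta> \<^bold>\<and> \<gamma>)) U"
      by (simp add: wedge_def sum_distrib_left)
    finally show ?thesis .
  qed (simp add: wedge_infinite)
qed

lemma wedge_even_commute:
  assumes "\<delta> \<in> W_deg N 2"
  shows "\<delta> \<^bold>\<and> \<alpha> = \<alpha> \<^bold>\<and> \<delta>"
proof (rule ext)
  fix U :: "nat set"
  show "(\<delta> \<^bold>\<and> \<alpha>) U = (\<alpha> \<^bold>\<and> \<delta>) U"
  proof (cases "finite U")
    case fin: True
    show ?thesis unfolding wedge_def
    proof (rule sum.reindex_bij_witness[of _ "\<lambda>S. U - S" "\<lambda>S. U - S"], goal_cases)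
      case (5 S)
      then have US: "U - (U - S) = S" by auto
      show ?case
      proof (cases "\<delta> S = 0")
        case False
        then have c: "card S = 2" using assms by (auto simp: W_deg_def)
        have f: "finite S" "finite (U - S)" using 5 fin by (auto intro: finite_subset)
        have "shuffle_sign S (U - S) * shuffle_sign (U - S) S = 1"
          using shuffle_sign_swap[OF f] c by auto
        then have "shuffle_sign S (U - S) = shuffle_sign (U - S) S"
          by (metis mult.right_neutral mult.left_commute shuffle_sign_square)
        then show ?thesis by (simp add: US mult_ac)
      qed (simp add: US)
    qed auto
  qed (simp add: wedge_infinite)
qed

lemma W_deg_subset: "W_deg N n \<subseteq> W N" by (auto simp: W_def W_deg_def)

lemma W_deg_add:
  fixes \<alpha> \<beta> :: "nat set \<Rightarrow> 'v::comm_monoid_add"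
  assumes "\<alpha> \<in> W_deg N n" "\<beta> \<in> W_deg N n"
  shows "\<alpha> + \<beta> \<in> W_deg N n"
proof -
  have "\<alpha> S \<noteq> 0 \<or> \<beta> S \<noteq> 0" if "(\<alpha> + \<beta>) S \<noteq> 0" for S using that by auto
  then show ?thesis using assms unfolding W_deg_def by blast
qed
lemma W_add:
  fixes \<alpha> \<beta> :: "nat set \<Rightarrow> 'v::comm_monoid_add"
  assumes "\<alpha> \<in> W N" "\<beta> \<in> W N"
  shows "\<alpha> + \<beta> \<in> W N"
proof -
  have "\<alpha> S \<noteq> 0 \<or> \<beta> S \<noteq> 0" if "(\<alpha> + \<beta>) S \<noteq> 0" for S using that by auto
  then show ?thesis using assms unfolding W_def by blast
qed
lemma W_zero: "0 \<in> W N" "0 \<in> W_deg N n" by (auto simp: W_def W_deg_def)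
lemma W_escale: "\<alpha> \<in> W N \<Longrightarrow> escale c \<alpha> \<in> W N" "\<alpha> \<in> W_deg N n \<Longrightarrow> escale c \<alpha> \<in> W_deg N n"
  by (auto simp: W_def W_deg_def escale_def)
lemma W_sum:
  fixes f :: "'i \<Rightarrow> nat set \<Rightarrow> 'v::comm_monoid_add"
  shows "(\<And>i. i \<in> A \<Longrightarrow> f i \<in> W N) \<Longrightarrow> (\<Sum>i\<in>A. f i) \<in> W N"
proof (induction A rule: infinite_finite_induct)
  case (insert x A)
  show ?case unfolding sum.insert[OF insert.hyps] by (intro W_add insert.IH insert.prems) simp_all
qed (simp_all only: sum.infinite sum.empty W_zero not_False_eq_True simp_thms)
lemma W_deg_sum:
  fixes f :: "'i \<Rightarrow> nat set \<Rightarrow> 'v::comm_monoid_add"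
  shows "(\<And>i. i \<in> A \<Longrightarrow> f i \<in> W_deg N n) \<Longrightarrow> (\<Sum>i\<in>A. f i) \<in> W_deg N n"
proof (induction A rule: infinite_finite_induct)
  case (insert x A)
  show ?case unfolding sum.insert[OF insert.hyps] by (intro W_deg_add insert.IH insert.prems) simp_all
qed (simp_all only: sum.infinite sum.empty W_zero not_False_eq_True simp_thms)

lemma wedge_W: assumes "\<alpha> \<in> W N" "\<beta> \<in> W N" shows "\<alpha> \<^bold>\<and> \<beta> \<in> W N"
proof -
  have "U \<subseteq> {1..N}" if "(\<alpha> \<^bold>\<and> \<beta>) U \<noteq> 0" for U
  proof -
    obtain S where "S \<subseteq> U" "\<alpha> S \<noteq> 0" "\<beta> (U - S) \<noteq> 0"
      using \<open>(\<alpha> \<^bold>\<and> \<beta>) U \<noteq> 0\<close> unfolding wedge_def by (auto elim!: sum.not_neutral_contains_not_neutral)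
    then show ?thesis using assms unfolding W_def by blast
  qed
  then show ?thesis by (auto simp: W_def)
qed

lemma wedge_W_deg: assumes "\<alpha> \<in> W_deg N p" "\<beta> \<in> W_deg N q" shows "\<alpha> \<^bold>\<and> \<beta> \<in> W_deg N (p + q)"
proof -
  have "U \<subseteq> {1..N} \<and> card U = p + q" if "(\<alpha> \<^bold>\<and> \<beta>) U \<noteq> 0" for U
  proof -
    obtain S where S: "S \<subseteq> U" "\<alpha> S \<noteq> 0" "\<beta> (U - S) \<noteq> 0"
      using \<open>(\<alpha> \<^bold>\<and> \<beta>) U \<noteq> 0\<close> unfolding wedge_def by (auto elim!: sum.not_neutral_contains_not_neutral)
    then have *: "S \<subseteq> {1..N}" "card S = p" "U - S \<subseteq> {1..N}" "card (U - S) = q"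
      using assms unfolding W_deg_def by blast+
    then have "finite S" "finite (U - S)" by (meson finite_atLeastAtMost finite_subset)+
    then have "card (S \<union> (U - S)) = card S + card (U - S)" by (intro card_Un_disjoint) auto
    then show ?thesis using * S(1) by (metis Un_Diff_cancel Un_absorb1 Un_least)
  qed
  then show ?thesis by (auto simp: W_deg_def)
qed

lemma mono_form_W: "S \<subseteq> {1..N} \<Longrightarrow> mono_form S \<in> W N" "S \<subseteq> {1..N} \<Longrightarrow> mono_form S \<in> W_deg N (card S)"
  by (auto simp: W_def W_deg_def mono_form_def)

lemma mono_form_expansion:
  assumes "\<beta> \<in> W N"
  shows "\<beta> = (\<Sum>S\<in>Pow {1..N}. escale (\<beta> S) (mono_form S))"
proof
  fix T
  have "(\<Sum>S\<in>Pow {1..N}. escale (\<beta> S) (mono_form S)) T = (\<Sum>S\<in>Pow {1..N}. if S = T then \<beta> S else 0)"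
    unfolding sum_fun_apply by (intro sum.cong) (auto simp: escale_def mono_form_def)
  also have "\<dots> = (if T \<in> Pow {1..N} then \<beta> T else 0)" by (rule sum.delta) simp
  also have "\<dots> = \<beta> T" using assms unfolding W_def by auto
  finally show "\<beta> T = (\<Sum>S\<in>Pow {1..N}. escale (\<beta> S) (mono_form S)) T" ..
qed

lemma mono_form_linear:
  fixes h :: "(nat set \<Rightarrow> complex) \<Rightarrow> 'w::ab_group_add"
  assumes "\<beta> \<in> W N"
    and add: "\<And>\<alpha> \<beta>. \<alpha> \<in> W N \<Longrightarrow> \<beta> \<in> W N \<Longrightarrow> h (\<alpha> + \<beta>) = h \<alpha> + h \<beta>"
    and scale: "\<And>c \<alpha>. \<alpha> \<in> W N \<Longrightarrow> h (escale c \<alpha>) = sw c (h \<alpha>)"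
  shows "h \<beta> = (\<Sum>S\<in>Pow {1..N}. sw (\<beta> S) (h (mono_form S)))"
proof -
  have h0: "h 0 = 0" using add[OF W_zero(1) W_zero(1)] by simp
  have "h (\<Sum>S\<in>A. escale (\<beta> S) (mono_form S)) = (\<Sum>S\<in>A. sw (\<beta> S) (h (mono_form S)))"
    if "A \<subseteq> Pow {1..N}" for A
    using that
  proof (induction A rule: infinite_finite_induct)
    case (insert S A)
    have W: "mono_form S \<in> W N" "escale (\<beta> S) (mono_form S) \<in> W N" "(\<Sum>S\<in>A. escale (\<beta> S) (mono_form S)) \<in> W N"
      using insert.prems by (auto intro!: W_sum W_escale(1) mono_form_W(1) simp del: One_nat_def)
    have "h (\<Sum>S\<in>A. escale (\<beta> S) (mono_form S)) = (\<Sum>S\<in>A. sw (\<beta> S) (h (mono_form S)))"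
      using insert.prems by (intro insert.IH) auto
    then show ?case
      by (simp only: sum.insert[OF insert.hyps] add[OF W(2,3)] scale[OF W(1)])
  qed (simp_all only: sum.infinite sum.empty h0 not_False_eq_True simp_thms)
  from this[OF subset_refl] show ?thesis using mono_form_expansion[OF assms(1)] by simp
qed

lemma mono_form_wedge:
  assumes "finite S" "finite T" "S \<inter> T = {}"
  shows "mono_form S \<^bold>\<and> mono_form T = escale (shuffle_sign S T) (mono_form (S \<union> T))"
proof
  fix U
  show "(mono_form S \<^bold>\<and> mono_form T) U = escale (shuffle_sign S T) (mono_form (S \<union> T)) U"
  proof (cases "finite U")
    case True
    have "(mono_form S \<^bold>\<and> mono_form T) U =
        (\<Sum>S'\<in>Pow U. if S' = S then shuffle_sign S (U - S) * mono_form T (U - S) else 0)"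
      by (auto simp: wedge_def mono_form_def intro!: sum.cong)
    also have "\<dots> = (if S \<subseteq> U then shuffle_sign S (U - S) * mono_form T (U - S) else 0)"
      using True by simp
    also have "\<dots> = escale (shuffle_sign S T) (mono_form (S \<union> T)) U"
      using assms(3) by (auto simp: escale_def mono_form_def)
    finally show ?thesis .
  next
    case False
    then show ?thesis using assms by (auto simp: wedge_infinite escale_def mono_form_def)
  qed
qed

lemma wedge_unit:
  assumes "\<delta> \<in> W N"
  shows "\<delta> \<^bold>\<and> mono_form {} = \<delta>" "mono_form {} \<^bold>\<and> \<delta> = \<delta>"
proof -
  have "(\<delta> \<^bold>\<and> mono_form {}) U = \<delta> U \<and> (mono_form {} \<^bold>\<and> \<delta>) U = \<delta> U" for U
  proof (cases "finite U")
    case True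
    have "(\<delta> \<^bold>\<and> mono_form {}) U = (\<Sum>S\<in>Pow U. if S = U then \<delta> U else 0)"
      unfolding wedge_def by (intro sum.cong) (auto simp: mono_form_def)
    moreover have "(mono_form {} \<^bold>\<and> \<delta>) U = (\<Sum>S\<in>Pow U. if S = {} then \<delta> U else 0)"
      unfolding wedge_def by (intro sum.cong) (auto simp: mono_form_def)
    ultimately show ?thesis using True by simp
  next
    case False
    then have "\<delta> U = 0" using assms by (auto simp: W_def dest: finite_subset)
    then show ?thesis using False by (simp add: wedge_infinite)
  qed
  then show "\<delta> \<^bold>\<and> mono_form {} = \<delta>" "mono_form {} \<^bold>\<and> \<delta> = \<delta>" by auto
qed

lemma mono_form_gen_Min:
  assumes "finite S" "S \<noteq> {}"
  shows "mono_form S = gen (Min S) \<^bold>\<and> mono_form (S - {Min S})"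
proof -
  have "{(s, t). s \<in> {Min S} \<and> t \<in> S - {Min S} \<and> t < s} = {}"
    using assms by (auto simp: not_less[symmetric])
  then have "shuffle_sign {Min S} (S - {Min S}) = 1" unfolding shuffle_sign_def by (simp only: card.empty power_0)
  moreover have "insert (Min S) S = S" using Min_in[OF assms] by auto
  ultimately show ?thesis using assms by (subst mono_form_wedge) (auto simp: escale_def)
qed

text \<open>The partial contraction by the \<open>i\<close>-th basis vector, and the parity involution.\<close>

definition pcontract :: "nat \<Rightarrow> (nat set \<Rightarrow> complex) \<Rightarrow> nat set \<Rightarrow> complex" where
  "pcontract i \<beta> = (\<lambda>T. if i \<in> T then 0 else shuffle_sign {i} T * \<beta> (insert i T))"

lemma sum_Pow_insert:
  assumes "finite U" "i \<notin> U"
  shows "(\<Sum>S\<in>Pow (insert i U). f S) = (\<Sum>S\<in>Pow U. f S) + (\<Sum>S\<in>Pow U. f (insert i S))"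
proof -
  have "inj_on (insert i) (Pow U)" using assms(2) by (auto simp: inj_on_def)
  moreover have "Pow U \<inter> insert i ` Pow U = {}" using assms(2) by auto
  ultimately show ?thesis using assms by (simp add: Pow_insert sum.union_disjoint sum.reindex)
qed

lemma pcontract_wedge:
  "pcontract i (\<alpha> \<^bold>\<and> \<beta>) = pcontract i \<alpha> \<^bold>\<and> \<beta> + (\<lambda>S. (-1) ^ card S * \<alpha> S) \<^bold>\<and> pcontract i \<beta>"
proof
  fix U :: "nat set"
  let ?e = "\<lambda>S. (-1) ^ card S * \<alpha> S"
  consider "infinite U" | "finite U" "i \<notin> U" | "finite U" "i \<in> U" by blast
  then show "pcontract i (\<alpha> \<^bold>\<and> \<beta>) U = (pcontract i \<alpha> \<^bold>\<and> \<beta> + ?e \<^bold>\<and> pcontract i \<beta>) U"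
  proof cases
    case 1 then show ?thesis by (simp add: pcontract_def wedge_infinite)
  next
    case 2
    have *: "shuffle_sign {i} U * (shuffle_sign S (insert i U - S) * \<alpha> S * \<beta> (insert i U - S)) =
        shuffle_sign S (U - S) * ?e S * pcontract i \<beta> (U - S)" (is ?A)
      "shuffle_sign {i} U * (shuffle_sign (insert i S) (insert i U - insert i S) * \<alpha> (insert i S) * \<beta> (insert i U - insert i S)) =
        shuffle_sign S (U - S) * pcontract i \<alpha> S * \<beta> (U - S)" (is ?B) if S: "S \<subseteq> U" for S
    proof -
      let ?T = "U - S"
      have f: "finite S" "finite ?T" "i \<notin> S" "i \<notin> ?T" using S 2 by (auto intro: finite_subset)
      have e: "insert i U - S = {i} \<union> ?T" "insert i U - insert i S = ?T" "insert i S = {i} \<union> S" using f by auto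
      have U: "shuffle_sign {i} U = shuffle_sign {i} S * shuffle_sign {i} ?T"
        using shuffle_sign_Un_right[of S ?T "{i}"] f S by (simp add: Un_absorb1)
      have sw: "shuffle_sign {i} S * shuffle_sign S {i} = (-1) ^ card S"
        using shuffle_sign_swap[of "{i}" S] f by simp
      have r: "shuffle_sign S ({i} \<union> ?T) = shuffle_sign S {i} * shuffle_sign S ?T"
        by (rule shuffle_sign_Un_right) (use f in auto)
      have l: "shuffle_sign ({i} \<union> S) ?T = shuffle_sign {i} ?T * shuffle_sign S ?T"
        by (rule shuffle_sign_Un_left) (use f in auto)
      have "shuffle_sign {i} U * (shuffle_sign S (insert i U - S) * \<alpha> S * \<beta> (insert i U - S))
        = (shuffle_sign {i} S * shuffle_sign S {i}) * shuffle_sign S ?T * \<alpha> S * (shuffle_sign {i} ?T * \<beta> (insert i ?T))"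
        unfolding e(1) U r by (simp add: mult_ac)
      then show ?A unfolding sw using f by (simp add: pcontract_def mult_ac)
      have "shuffle_sign {i} U * (shuffle_sign (insert i S) (insert i U - insert i S) * \<alpha> (insert i S) * \<beta> (insert i U - insert i S))
        = (shuffle_sign {i} ?T * shuffle_sign {i} ?T) * (shuffle_sign S ?T * (shuffle_sign {i} S * \<alpha> (insert i S)) * \<beta> ?T)"
        unfolding e(2) unfolding e(3) U l by (simp add: mult_ac del: shuffle_sign_square)
      then show ?B using f by (simp add: pcontract_def mult_ac)
    qed
    have "pcontract i (\<alpha> \<^bold>\<and> \<beta>) U = (\<Sum>S\<in>Pow U. shuffle_sign {i} U * (shuffle_sign S (insert i U - S) * \<alpha> S * \<beta> (insert i U - S)))
      + (\<Sum>S\<in>Pow U. shuffle_sign {i} U * (shuffle_sign (insert i S) (insert i U - insert i S) * \<alpha> (insert i S) * \<beta> (insert i U - insert i S)))"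
      by (simp only: pcontract_def wedge_def 2(2) if_False sum_Pow_insert[OF 2] distrib_left sum_distrib_left)
    also have "\<dots> = (?e \<^bold>\<and> pcontract i \<beta>) U + (pcontract i \<alpha> \<^bold>\<and> \<beta>) U"
      unfolding wedge_def by (intro arg_cong2[of _ _ _ _ "(+)"] sum.cong) (use * in auto)
    finally show ?thesis by simp
  next
    case 3
    define U' where "U' = U - {i}"
    have U': "U = insert i U'" "finite U'" "i \<notin> U'" using 3 by (auto simp: U'_def)
    have *: "shuffle_sign S (U - S) * pcontract i \<alpha> S * \<beta> (U - S) +
        shuffle_sign (insert i S) (U - insert i S) * ?e (insert i S) * pcontract i \<beta> (U - insert i S) = 0"
      if S: "S \<subseteq> U'" for S
    proof -
      let ?T = "U' - S"
      have f: "finite S" "finite ?T" "i \<notin> S" "i \<notin> ?T" using S U' by (auto intro: finite_subset)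
      have e: "U - S = {i} \<union> ?T" "U - insert i S = ?T" "insert i S = {i} \<union> S" using f U' by auto
      have sw: "shuffle_sign {i} S * shuffle_sign S {i} = (-1) ^ card S"
        using shuffle_sign_swap[of "{i}" S] f by simp
      have r: "shuffle_sign S ({i} \<union> ?T) = shuffle_sign S {i} * shuffle_sign S ?T"
        by (rule shuffle_sign_Un_right) (use f in auto)
      have l: "shuffle_sign ({i} \<union> S) ?T = shuffle_sign {i} ?T * shuffle_sign S ?T"
        by (rule shuffle_sign_Un_left) (use f in auto)
      have c: "(-1::complex) ^ card ({i} \<union> S) = - (shuffle_sign {i} S * shuffle_sign S {i})" using f sw by simp
      have q: "shuffle_sign {i} ?T * shuffle_sign {i} ?T = 1" by simp
      have pa: "pcontract i \<alpha> S = shuffle_sign {i} S * \<alpha> ({i} \<union> S)"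
        and pb: "pcontract i \<beta> ?T = shuffle_sign {i} ?T * \<beta> ({i} \<union> ?T)"
        using f by (auto simp: pcontract_def)
      show ?thesis unfolding e(2) pa pb unfolding e(1,3) c r l using q by algebra
    qed
    have "(pcontract i \<alpha> \<^bold>\<and> \<beta>) U = (\<Sum>S\<in>Pow U'. shuffle_sign S (U - S) * pcontract i \<alpha> S * \<beta> (U - S))"
      unfolding wedge_def using U' by (simp add: sum_Pow_insert pcontract_def)
    moreover have "(?e \<^bold>\<and> pcontract i \<beta>) U = (\<Sum>S\<in>Pow U'. shuffle_sign (insert i S) (U - insert i S) * ?e (insert i S) * pcontract i \<beta> (U - insert i S))"
    proof -
      have z: "pcontract i \<beta> (U - S) = 0" if "S \<subseteq> U'" for S using that U' by (auto simp: pcontract_def)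
      show ?thesis unfolding wedge_def using U'(2,3) z unfolding U'(1)
        by (subst sum_Pow_insert) (simp_all only: finite_insert, simp_all add: U'(1))
    qed
    ultimately have "(pcontract i \<alpha> \<^bold>\<and> \<beta> + ?e \<^bold>\<and> pcontract i \<beta>) U = (\<Sum>S\<in>Pow U'. shuffle_sign S (U - S) * pcontract i \<alpha> S * \<beta> (U - S) +
        shuffle_sign (insert i S) (U - insert i S) * ?e (insert i S) * pcontract i \<beta> (U - insert i S))"
      by (simp add: sum.distrib)
    also have "\<dots> = 0" using * by (intro sum.neutral) auto
    finally show ?thesis using 3 by (simp add: pcontract_def)
  qed
qed

lemma contract_pcontract: "contract N \<theta> x \<beta> = (\<Sum>i=1..N. escale (\<theta> i x) (pcontract i \<beta>))"
proof
  fix T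
  have "contract N \<theta> x \<beta> T = (\<Sum>i\<in>{1..N} - T. \<theta> i x * pcontract i \<beta> T)"
    by (auto simp: contract_def pcontract_def intro!: sum.cong)
  also have "\<dots> = (\<Sum>i=1..N. \<theta> i x * pcontract i \<beta> T)"
    by (rule sum.mono_neutral_left) (auto simp: pcontract_def)
  finally show "contract N \<theta> x \<beta> T = (\<Sum>i=1..N. escale (\<theta> i x) (pcontract i \<beta>)) T"
    by (simp add: sum_fun_apply escale_def)
qed

lemma parity_escale: "\<alpha> \<in> W_deg N p \<Longrightarrow> (\<lambda>S. (-1) ^ card S * \<alpha> S) = escale ((-1) ^ p) \<alpha>"
  by (rule ext) (auto simp: W_deg_def escale_def)

lemma contract_gen: "i \<in> {1..N} \<Longrightarrow> contract N \<theta> x (gen i) = escale (\<theta> i x) (mono_form {})"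
proof
  fix T assume i: "i \<in> {1..N}"
  have "contract N \<theta> x (gen i) T = (\<Sum>j\<in>{1..N} - T. if j = i \<and> T = {} then \<theta> i x else 0)"
    unfolding contract_def by (intro sum.cong) (auto simp: mono_form_def shuffle_sign_def)
  also have "\<dots> = escale (\<theta> i x) (mono_form {}) T" using i by (cases "T = {}") (auto simp: escale_def mono_form_def)
  finally show "contract N \<theta> x (gen i) T = escale (\<theta> i x) (mono_form {}) T" .
qed

lemma contract_antiderivation:
  assumes "\<alpha> \<in> W_deg N p"
  shows "contract N \<theta> x (\<alpha> \<^bold>\<and> \<beta>) = contract N \<theta> x \<alpha> \<^bold>\<and> \<beta> + escale ((-1) ^ p) (\<alpha> \<^bold>\<and> contract N \<theta> x \<beta>)"
proof -
  have "escale c (escale d \<gamma>) = escale d (escale c \<gamma>)" for c d \<gamma> by (auto simp: escale_def)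
  then show ?thesis
    by (simp add: contract_pcontract pcontract_wedge parity_escale[OF assms] wedge_sum_left wedge_sum_right
      wedge_escale_left wedge_escale_right escale_add escale_sum sum.distrib)
qed

lemma pcontract_add: "pcontract i (\<alpha> + \<beta>) = pcontract i \<alpha> + pcontract i \<beta>"
  by (rule ext) (simp add: pcontract_def algebra_simps)
lemma pcontract_escale: "pcontract i (escale c \<alpha>) = escale c (pcontract i \<alpha>)"
  by (rule ext) (simp add: pcontract_def escale_def)
lemma pcontract_W: "i \<in> {1..N} \<Longrightarrow> \<beta> \<in> W N \<Longrightarrow> pcontract i \<beta> \<in> W N"
  by (auto simp: W_def pcontract_def)
lemma pcontract_W_deg: assumes "\<beta> \<in> W_deg N p" shows "p > 0 \<Longrightarrow> pcontract i \<beta> \<in> W_deg N (p - 1)" "p = 0 \<Longrightarrow> pcontract i \<beta> = 0"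
proof -
  have *: "T \<subseteq> {1..N} \<and> Suc (card T) = p" if "pcontract i \<beta> T \<noteq> 0" for T
  proof -
    have h: "i \<notin> T" "insert i T \<subseteq> {1..N}" "card (insert i T) = p"
      using that assms by (auto simp: pcontract_def W_deg_def split: if_splits)
    then have "finite T" by (meson finite_atLeastAtMost finite_insert finite_subset)
    then show ?thesis using h by auto
  qed
  show "p > 0 \<Longrightarrow> pcontract i \<beta> \<in> W_deg N (p - 1)" using * unfolding W_deg_def by fastforce
  show "p = 0 \<Longrightarrow> pcontract i \<beta> = 0" using * by fastforce
qed

lemma right_sym_moduleD:
  assumes "right_sym_module sg sv acts"
  shows "vector_space sv" and "p \<in> sym_algebra sg \<Longrightarrow> Vector_Spaces.linear sv sv (\<lambda>v. acts v p)"
    and "p \<in> sym_algebra sg \<Longrightarrow> q \<in> sym_algebra sg \<Longrightarrow> acts v (p + q) = acts v p + acts v q"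
    and "acts v (\<lambda>_. c) = sv c v"
    and "p \<in> sym_algebra sg \<Longrightarrow> q \<in> sym_algebra sg \<Longrightarrow> acts v (p * q) = acts (acts v p) q"
proof -
  note D = assms[unfolded right_sym_module_def]
  show "vector_space sv"
    by (rule D[THEN conjunct1])
  show "p \<in> sym_algebra sg \<Longrightarrow> Vector_Spaces.linear sv sv (\<lambda>v. acts v p)"
    by (rule D[THEN conjunct2, THEN conjunct1, rule_format])
  show "p \<in> sym_algebra sg \<Longrightarrow> q \<in> sym_algebra sg \<Longrightarrow> acts v (p + q) = acts v p + acts v q"
    by (rule D[THEN conjunct2, THEN conjunct2, THEN conjunct1, rule_format])
  show "acts v (\<lambda>_. c) = sv c v"
    by (rule D[THEN conjunct2, THEN conjunct2, THEN conjunct2, THEN conjunct1, rule_format])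
  show "p \<in> sym_algebra sg \<Longrightarrow> q \<in> sym_algebra sg \<Longrightarrow> acts v (p * q) = acts (acts v p) q"
    by (rule D[THEN conjunct2, THEN conjunct2, THEN conjunct2, THEN conjunct2, rule_format])
qed

lemma is_dR_exists: "\<exists>d. is_dR N C d \<and> (\<forall>\<beta>. \<beta> \<notin> W N \<longrightarrow> d \<beta> = 0)"
proof -
  define g where "g i = escale (- 1 / 2) (\<Sum>j=1..N. \<Sum>k=1..N. escale (C i j k) (gen j \<^bold>\<and> gen k))" for i
  define d where "d \<beta> = (\<Sum>i=1..N. g i \<^bold>\<and> pcontract i \<beta>)" for \<beta>
  have gW: "g i \<in> W_deg N 2" for i
  proof -
    have "gen j \<^bold>\<and> gen k \<in> W_deg N 2" if "j \<in> {1..N}" "k \<in> {1..N}" for j k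
      using wedge_W_deg[OF mono_form_W(2)[of "{j}"] mono_form_W(2)[of "{k}"]] that by (simp add: numeral_2_eq_2)
    then show ?thesis unfolding g_def by (intro W_escale W_deg_sum)
  qed
  have add: "d (\<alpha> + \<beta>) = d \<alpha> + d \<beta>" for \<alpha> \<beta>
    by (simp add: d_def pcontract_add wedge_add_right sum.distrib)
  have scale: "d (escale c \<alpha>) = escale c (d \<alpha>)" for c \<alpha>
    by (simp add: d_def pcontract_escale wedge_escale_right escale_sum)
  have deg: "d \<alpha> \<in> W_deg N (p + 1)" if "\<alpha> \<in> W_deg N p" for p \<alpha>
    unfolding d_def
  proof (rule W_deg_sum)
    fix i
    show "g i \<^bold>\<and> pcontract i \<alpha> \<in> W_deg N (p + 1)"
    proof (cases "p = 0")
      case True then show ?thesis using pcontract_W_deg(2)[OF that] by (simp add: wedge_zero_right W_zero)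
    next
      case False
      then show ?thesis using wedge_W_deg[OF gW pcontract_W_deg(1)[OF that]] by fastforce
    qed
  qed
  have leibniz: "d (\<alpha> \<^bold>\<and> \<beta>) = d \<alpha> \<^bold>\<and> \<beta> + escale ((-1) ^ p) (\<alpha> \<^bold>\<and> d \<beta>)" if "\<alpha> \<in> W_deg N p" for p \<alpha> \<beta>
  proof -
    have "g i \<^bold>\<and> (\<alpha> \<^bold>\<and> pcontract i \<beta>) = \<alpha> \<^bold>\<and> (g i \<^bold>\<and> pcontract i \<beta>)" for i
      using wedge_even_commute[OF gW, of i \<alpha>] by (simp flip: wedge_assoc)
    then show ?thesis
      by (simp add: d_def pcontract_wedge parity_escale[OF that] wedge_sum_left wedge_sum_right wedge_assoc
        wedge_add_right wedge_escale_left wedge_escale_right escale_sum sum.distrib)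
  qed
  have gens: "d (gen i) = g i" if "i \<in> {1..N}" for i
  proof -
    have p: "pcontract j (gen i) = (if j = i then mono_form {} else 0)" for j
      by (rule ext) (auto simp: pcontract_def mono_form_def shuffle_sign_def)
    have "d (gen i) = (\<Sum>j=1..N. if j = i then g i \<^bold>\<and> mono_form {} else 0)"
      unfolding d_def p by (intro sum.cong) (auto simp: wedge_zero_right)
    then show ?thesis using that wedge_unit(1)[of "g i" N] gW[of i] W_deg_subset[of N 2, where 'a=complex] by auto
  qed
  have "is_dR N C (\<lambda>\<beta>. if \<beta> \<in> W N then d \<beta> else 0)"
    unfolding is_dR_def g_def[symmetric] using W_deg_subset[of N, where 'a=complex] deg
    by (auto simp: W_add W_escale wedge_W add scale leibniz gens mono_form_W subset_eq)
  then show ?thesis by (intro exI[of _ "\<lambda>\<beta>. if \<beta> \<in> W N then d \<beta> else 0"]) auto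
qed

lemma is_dRD:
  assumes "is_dR N C d"
  shows "\<alpha> \<in> W N \<Longrightarrow> \<beta> \<in> W N \<Longrightarrow> d (\<alpha> + \<beta>) = d \<alpha> + d \<beta>"
    and "\<alpha> \<in> W N \<Longrightarrow> d (escale c \<alpha>) = escale c (d \<alpha>)"
    and "\<alpha> \<in> W_deg N p \<Longrightarrow> d \<alpha> \<in> W_deg N (p + 1)"
    and "\<alpha> \<in> W_deg N p \<Longrightarrow> \<beta> \<in> W N \<Longrightarrow> d (\<alpha> \<^bold>\<and> \<beta>) = d \<alpha> \<^bold>\<and> \<beta> + escale ((-1) ^ p) (\<alpha> \<^bold>\<and> d \<beta>)"
    and "i \<in> {1..N} \<Longrightarrow> d (gen i) = escale (- 1 / 2) (\<Sum>j=1..N. \<Sum>k=1..N. escale (C i j k) (gen j \<^bold>\<and> gen k))"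
proof -
  note D = assms[unfolded is_dR_def]
  show "\<alpha> \<in> W N \<Longrightarrow> \<beta> \<in> W N \<Longrightarrow> d (\<alpha> + \<beta>) = d \<alpha> + d \<beta>"
    by (rule D[THEN conjunct1, rule_format])
  show "\<alpha> \<in> W N \<Longrightarrow> d (escale c \<alpha>) = escale c (d \<alpha>)"
    by (rule D[THEN conjunct2, THEN conjunct1, rule_format])
  show "\<alpha> \<in> W_deg N p \<Longrightarrow> d \<alpha> \<in> W_deg N (p + 1)"
    by (rule D[THEN conjunct2, THEN conjunct2, THEN conjunct1, rule_format])
  show "\<alpha> \<in> W_deg N p \<Longrightarrow> \<beta> \<in> W N \<Longrightarrow> d (\<alpha> \<^bold>\<and> \<beta>) = d \<alpha> \<^bold>\<and> \<beta> + escale ((-1) ^ p) (\<alpha> \<^bold>\<and> d \<beta>)"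
    by (rule D[THEN conjunct2, THEN conjunct2, THEN conjunct2, THEN conjunct1, rule_format])
  show "i \<in> {1..N} \<Longrightarrow> d (gen i) = escale (- 1 / 2) (\<Sum>j=1..N. \<Sum>k=1..N. escale (C i j k) (gen j \<^bold>\<and> gen k))"
    by (rule D[THEN conjunct2, THEN conjunct2, THEN conjunct2, THEN conjunct2, rule_format])
qed

lemma is_dR_determined:
  assumes d: "is_dR N C d" and d': "is_dR N C d'" and "\<beta> \<in> W N"
  shows "d \<beta> = d' \<beta>"
proof -
  have mono: "f (mono_form S) = f' (mono_form S)"
    if "is_dR N C f" "is_dR N C f'" "S \<subseteq> {1..N}" for f f' S
    using that(3)
  proof (induction "card S" arbitrary: S rule: less_induct)
    case less
    have fin: "finite S" using less.prems by (meson finite_atLeastAtMost finite_subset)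
    show ?case
    proof (cases "S = {}")
      case True
      have m: "mono_form {} \<in> W_deg N 0" "mono_form {} \<in> W N" using mono_form_W[of "{}" N] by auto
      have "h (mono_form {}) = 0" if h: "is_dR N C h" for h
      proof -
        have hW: "h (mono_form {}) \<in> W N" using is_dRD(3)[OF h m(1)] W_deg_subset by blast
        have "h (mono_form {} \<^bold>\<and> mono_form {}) =
            h (mono_form {}) \<^bold>\<and> mono_form {} + escale ((-1) ^ 0) (mono_form {} \<^bold>\<and> h (mono_form {}))"
          by (rule is_dRD(4)[OF h m])
        then show ?thesis using wedge_unit[OF hW] wedge_unit[OF m(2)] by (simp add: escale_def)
      qed
      then show ?thesis using that(1,2) True by metis
    next
      case False
      define i T where "i = Min S" and "T = S - {i}"
      have i: "i \<in> S" using fin False by (simp add: i_def)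
      have "card T < card S" using i fin by (simp add: T_def card_gt_0_iff False)
      then have IH: "f (mono_form T) = f' (mono_form T)" using less.hyps less.prems by (auto simp: T_def)
      have S: "mono_form S = gen i \<^bold>\<and> mono_form T" using mono_form_gen_Min[OF fin False] by (simp add: i_def T_def)
      have m: "gen i \<in> W_deg N 1" "mono_form T \<in> W N"
        using mono_form_W(2)[of "{i}" N] mono_form_W(1)[of T N] i less.prems by (auto simp: T_def)
      have "f (gen i) = f' (gen i)" using is_dRD(5)[OF that(1)] is_dRD(5)[OF that(2)] i less.prems by (simp only: subset_iff)
      moreover have "f (mono_form S) = f (gen i) \<^bold>\<and> mono_form T + escale ((-1) ^ 1) (gen i \<^bold>\<and> f (mono_form T))"
        unfolding S by (rule is_dRD(4)[OF that(1) m])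
      moreover have "f' (mono_form S) = f' (gen i) \<^bold>\<and> mono_form T + escale ((-1) ^ 1) (gen i \<^bold>\<and> f' (mono_form T))"
        unfolding S by (rule is_dRD(4)[OF that(2) m])
      ultimately show ?thesis using IH by simp
    qed
  qed
  have lin: "h \<beta> = (\<Sum>S\<in>Pow {1..N}. escale (\<beta> S) (h (mono_form S)))" if h: "is_dR N C h" for h
    by (rule mono_form_linear[OF \<open>\<beta> \<in> W N\<close>]) (fact is_dRD(1,2)[OF h])+
  show ?thesis unfolding lin[OF d] lin[OF d'] using mono[OF d d'] by (intro sum.cong) auto
qed

lemma dR_unique: "\<exists>!d. is_dR N C d \<and> (\<forall>\<beta>. \<beta> \<notin> W N \<longrightarrow> d \<beta> = 0)"
proof -
  have "d = d'" if "is_dR N C d \<and> (\<forall>\<beta>. \<beta> \<notin> W N \<longrightarrow> d \<beta> = 0)" "is_dR N C d' \<and> (\<forall>\<beta>. \<beta> \<notin> W N \<longrightarrow> d' \<beta> = 0)" for d d'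
  proof
    fix \<beta>
    show "d \<beta> = d' \<beta>" using that is_dR_determined[of N C d d' \<beta>] by (cases "\<beta> \<in> W N") auto
  qed
  then show ?thesis using is_dR_exists by blast
qed

lemma dR_is_dR: "is_dR N C (dR N C)"
  unfolding dR_def by (rule theI'[OF dR_unique, THEN conjunct1])

text \<open>\<open>tensor_lift\<close> has the stated values on all pure tensors, so the differentials do as well.\<close>

lemma tensor_lift_tensor:
  fixes f :: "(nat set \<Rightarrow> complex) \<Rightarrow> 'v \<Rightarrow> 'w::ab_group_add"
  assumes "\<beta> \<in> W N"
    and "\<And>\<beta> \<gamma>. \<beta> \<in> W N \<Longrightarrow> \<gamma> \<in> W N \<Longrightarrow> f (\<beta> + \<gamma>) v = f \<beta> v + f \<gamma> v"
    and "\<And>c \<beta>. \<beta> \<in> W N \<Longrightarrow> f (escale c \<beta>) v = sw c (f \<beta> v)"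
    and "\<And>c \<beta>. \<beta> \<in> W N \<Longrightarrow> f \<beta> (sv c v) = sw c (f \<beta> v)"
  shows "tensor_lift N f (tensor sv \<beta> v) = f \<beta> v"
proof -
  have "f \<beta> v = (\<Sum>S\<in>Pow {1..N}. sw (\<beta> S) (f (mono_form S) v))"
    using assms by (intro mono_form_linear[where h = "\<lambda>\<beta>. f \<beta> v"])
  also have "\<dots> = tensor_lift N f (tensor sv \<beta> v)"
    unfolding tensor_lift_def tensor_def using assms(4) mono_form_W(1) by (intro sum.cong) auto
  finally show ?thesis ..
qed

lemma d_CE_tensor:
  assumes "right_lie_module UNIV sg br sv act" and "\<beta> \<in> W N"
  shows "d_CE br N X \<theta> sv act (tensor sv \<beta> v) =
    tensor sv (dR N (struct_const br X \<theta>) \<beta>) v - (\<Sum>i=1..N. tensor sv (gen i \<^bold>\<and> \<beta>) (act v (X i)))"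
proof -
  have vs: "vector_space sv" and lin: "\<And>x c v. act (sv c v) x = sv c (act v x)"
    using assms(1) by (auto simp: right_lie_module_def Vector_Spaces.linear_iff)
  interpret V: vector_space sv by (rule vs)
  note D = is_dRD(1,2)[OF dR_is_dR[of N "struct_const br X \<theta>"]]
  show ?thesis unfolding d_CE_def
    by (rule tensor_lift_tensor[where sw = "\<lambda>c w S. sv c (w S)", OF assms(2)], use D in
      \<open>auto simp: fun_eq_iff sum_fun_apply tensor_def escale_apply lin wedge_add_right wedge_escale_right
        sum.distrib V.scale_left_distrib V.scale_sum_right V.scale_right_diff_distrib mult.commute\<close>)
qed

lemma d_K_tensor:
  assumes "right_sym_module sg sv acts" and "dual_bases sg N X \<theta>" and "\<alpha> \<in> W N"
  shows "d_K N X \<theta> sv acts (tensor sv \<alpha> v) =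
    (\<Sum>i=1..N. tensor sv (contract N \<theta> (X i) \<alpha>) (acts v (\<theta> i)))"
proof -
  note vs = right_sym_moduleD(1)[OF assms(1)]
  have lin: "acts (sv c v) (\<theta> i) = sv c (acts v (\<theta> i))" if "i \<in> {1..N}" for i c v
    using right_sym_moduleD(2)[OF assms(1) sym_algebra.dual[OF dual_bases.dual_mem[OF assms(2) that]]]
    by (simp add: Vector_Spaces.linear_iff)
  interpret V: vector_space sv by (rule vs)
  have e: "escale c (escale d \<gamma>) = escale d (escale c \<gamma>)" for c d \<gamma> by (auto simp: escale_def)
  have add: "contract N \<theta> x (\<alpha> + \<beta>) = contract N \<theta> x \<alpha> + contract N \<theta> x \<beta>" 
    and sc: "contract N \<theta> x (escale c \<alpha>) = escale c (contract N \<theta> x \<alpha>)" for x \<alpha> \<beta> c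
    by (simp_all add: contract_pcontract pcontract_add pcontract_escale escale_add escale_sum sum.distrib e)
  show ?thesis unfolding d_K_def
    by (rule tensor_lift_tensor[where sw = "\<lambda>c w S. sv c (w S)", OF assms(3)])
      (auto simp: fun_eq_iff sum_fun_apply tensor_def escale_apply lin add sc
        sum.distrib V.scale_left_distrib V.scale_sum_right mult.commute)
qed

lemma (in dual_bases) expansion: "y = (\<Sum>i=1..N. sg (\<theta> i y) (X i))"
proof -
  have "y \<in> span (X ` {1..N})" using basis_span by simp
  then show ?thesis
  proof (induction rule: span_induct_alt)
    case base
    have "\<theta> i 0 = 0" if "i \<in> {1..N}" for i
      using dual_mem[OF that] by (simp add: dual_space_def Vector_Spaces.linear_iff) (metis mult_zero_left scale_zero_left)
    then show ?case by simp
  next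
    case (step c x y)
    then obtain j where j: "j \<in> {1..N}" "x = X j" by auto
    have "\<theta> i (sg c x + y) = c * (if i = j then 1 else 0) + \<theta> i y" if "i \<in> {1..N}" for i
      using dual_mem[OF that] dual_pairing[OF that j(1)] j(2) by (simp add: dual_space_def Vector_Spaces.linear_iff)
    then have "(\<Sum>i=1..N. sg (\<theta> i (sg c x + y)) (X i)) =
        (\<Sum>i=1..N. (if i = j then sg c (X i) else 0) + sg (\<theta> i y) (X i))"
      by (intro sum.cong) (auto simp: scale_left_distrib)
    also have "\<dots> = sg c x + y" using j step.IH by (simp add: sum.distrib)
    finally show ?case by simp
  qed
qed

lemma (in dual_bases) bracket_basis: "br (X j) (X k) = (\<Sum>i=1..N. sg (struct_const br X \<theta> i j k) (X i))"
  unfolding struct_const_def by (rule expansion)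

lemma (in dual_bases) coad_basis:
  assumes "Vector_Spaces.linear sg sg (br (X j))" and "t \<in> {1..N}"
  shows "coad br (X j) (\<theta> t) = (\<lambda>y. - (\<Sum>k=1..N. struct_const br X \<theta> t j k * \<theta> k y))"
proof
  fix y
  interpret b: Vector_Spaces.linear sg sg "br (X j)" by fact
  interpret t: Vector_Spaces.linear sg "(*)" "\<theta> t" using dual_mem[OF assms(2)] by (simp add: dual_space_def)
  have "\<theta> t (br (X j) y) = \<theta> t (br (X j) (\<Sum>k=1..N. sg (\<theta> k y) (X k)))" using expansion[of y] by simp
  then show "coad br (X j) (\<theta> t) y = - (\<Sum>k=1..N. struct_const br X \<theta> t j k * \<theta> k y)"
    by (simp add: coad_def b.sum b.scale t.sum t.scale struct_const_def mult.commute)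
qed

text \<open>The module condition over the semidirect product, in terms of the given actions and bases.\<close>

lemma right_sd_module_iff:
  fixes sv :: "complex \<Rightarrow> 'v::ab_group_add \<Rightarrow> 'v"
  assumes lie: "complex_lie_algebra sg br" and dual: "dual_bases sg N X \<theta>"
    and m: "right_lie_module UNIV sg br sv act" and s: "right_sym_module sg sv acts"
  shows "right_sd_module sg br sv act acts \<longleftrightarrow>
    (\<forall>v. \<forall>j\<in>{1..N}. \<forall>t\<in>{1..N}. acts (act v (X j)) (\<theta> t) = acts v (coad br (X j) (\<theta> t)) + act (acts v (\<theta> t)) (X j))"
    (is "?L \<longleftrightarrow> ?R")
proof -
  interpret complex_lie_algebra sg br by fact
  interpret dual_bases sg N X \<theta> by fact
  interpret V: vector_space sv using m by (simp add: right_lie_module_def)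
  have br: "br (x + x') y = br x y + br x' y" "br x (y + y') = br x y + br x y'"
    "br (sg c x) y = sg c (br x y)" "br x (sg c y) = sg c (br x y)" for x x' y y' c
    using linear_left linear_right by (simp_all add: Vector_Spaces.linear_iff)
  have br0: "br 0 x = 0" "br x 0 = 0" for x using br(3)[of 0 x x] br(4)[of x 0 x] by simp_all
  have dlin: "\<alpha> (x + y) = \<alpha> x + \<alpha> y" "\<alpha> (sg c x) = c * \<alpha> x" "\<alpha> 0 = 0" if "\<alpha> \<in> dual_space sg" for \<alpha> x y c
  proof -
    interpret a: Vector_Spaces.linear sg "(*)" \<alpha> using that by (simp add: dual_space_def)
    show "\<alpha> (x + y) = \<alpha> x + \<alpha> y" "\<alpha> (sg c x) = c * \<alpha> x" "\<alpha> 0 = 0" by (simp_all add: a.add a.scale a.zero)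
  qed
  have vsC: "vector_space ((*) :: complex \<Rightarrow> complex \<Rightarrow> complex)"
    by unfold_locales (simp_all add: algebra_simps)
  have dI: "\<alpha> \<in> dual_space sg" if "\<And>x y. \<alpha> (x + y) = \<alpha> x + \<alpha> y" "\<And>c x. \<alpha> (sg c x) = c * \<alpha> x" for \<alpha>
    using that vector_space_axioms vsC by (simp add: dual_space_def Vector_Spaces.linear_iff)
  have d0: "0 \<in> dual_space sg" by (rule dI) simp_all
  have dadd: "\<alpha> + \<beta> \<in> dual_space sg" if "\<alpha> \<in> dual_space sg" "\<beta> \<in> dual_space sg" for \<alpha> \<beta>
    by (rule dI) (simp_all add: dlin[OF that(1)] dlin[OF that(2)] algebra_simps)
  have dsc: "(\<lambda>x. c * \<alpha> x) \<in> dual_space sg" if "\<alpha> \<in> dual_space sg" for \<alpha> c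
    by (rule dI) (simp_all add: dlin[OF that] algebra_simps)
  have ddiff: "\<alpha> - \<beta> \<in> dual_space sg" if "\<alpha> \<in> dual_space sg" "\<beta> \<in> dual_space sg" for \<alpha> \<beta>
    by (rule dI) (simp_all add: dlin[OF that(1)] dlin[OF that(2)] algebra_simps)
  have dco: "coad br x \<alpha> \<in> dual_space sg" if "\<alpha> \<in> dual_space sg" for x \<alpha>
    by (rule dI) (simp_all add: coad_def br dlin[OF that])
  have A: "act (v + w) x = act v x + act w x" "act (sv c v) x = sv c (act v x)"
    "act v (x + y) = act v x + act v y" "act v (sg c x) = sv c (act v x)"
    "act v (br x y) = act (act v x) y - act (act v y) x" for v w x y c
    using m by (auto simp: right_lie_module_def Vector_Spaces.linear_iff)
  have A0: "act v 0 = 0" "act 0 x = 0" for v x using A(3)[of v 0 0] A(1)[of 0 0 x] by simp_all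
  have S: "acts (v + w) \<alpha> = acts v \<alpha> + acts w \<alpha>" "acts (sv c v) \<alpha> = sv c (acts v \<alpha>)"
    "\<beta> \<in> dual_space sg \<Longrightarrow> acts v (\<alpha> + \<beta>) = acts v \<alpha> + acts v \<beta>"
    "acts v (\<lambda>x. c * \<alpha> x) = sv c (acts v \<alpha>)"
    "\<beta> \<in> dual_space sg \<Longrightarrow> acts (acts v \<alpha>) \<beta> = acts (acts v \<beta>) \<alpha>"
    if "\<alpha> \<in> dual_space sg" for v w \<alpha> \<beta> c
  proof -
    have a: "\<alpha> \<in> sym_algebra sg" using that by (rule sym_algebra.dual)
    then show "acts (v + w) \<alpha> = acts v \<alpha> + acts w \<alpha>" "acts (sv c v) \<alpha> = sv c (acts v \<alpha>)"
      using right_sym_moduleD(2)[OF s] by (simp_all add: Vector_Spaces.linear_iff)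
    show "acts v (\<alpha> + \<beta>) = acts v \<alpha> + acts v \<beta>" if "\<beta> \<in> dual_space sg"
      by (rule right_sym_moduleD(3)[OF s a sym_algebra.dual[OF that]])
    have "acts v (\<alpha> * (\<lambda>_. c)) = acts (acts v \<alpha>) (\<lambda>_. c)" "acts (acts v \<alpha>) (\<lambda>_. c) = sv c (acts v \<alpha>)"
      by (rule right_sym_moduleD(4,5)[OF s] a sym_algebra.const)+
    moreover have "\<alpha> * (\<lambda>_. c) = (\<lambda>x. c * \<alpha> x)" by (simp add: fun_eq_iff)
    ultimately show "acts v (\<lambda>x. c * \<alpha> x) = sv c (acts v \<alpha>)" by simp
    show "acts (acts v \<alpha>) \<beta> = acts (acts v \<beta>) \<alpha>" if "\<beta> \<in> dual_space sg"
    proof -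
      have "acts v (\<alpha> * \<beta>) = acts (acts v \<alpha>) \<beta>" "acts v (\<beta> * \<alpha>) = acts (acts v \<beta>) \<alpha>"
        by (rule right_sym_moduleD(5)[OF s] a sym_algebra.dual[OF that])+
      then show ?thesis by (simp add: mult.commute)
    qed
  qed
  have S0: "acts v 0 = 0" "\<alpha> \<in> dual_space sg \<Longrightarrow> acts 0 \<alpha> = 0" for v \<alpha>
    using S(3)[OF d0 d0, of v] S(1)[of \<alpha> 0 0] by simp_all
  have Sd: "acts v (\<alpha> - \<beta>) = acts v \<alpha> - acts v \<beta>" if "\<alpha> \<in> dual_space sg" "\<beta> \<in> dual_space sg" for v \<alpha> \<beta>
    using S(3)[OF ddiff[OF that] that(2), of v] by (simp add: algebra_simps)
  show ?thesis
  proof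
    assume ?L
    then have L: "sd_act act acts v (sd_bracket br p q) =
        sd_act act acts (sd_act act acts v p) q - sd_act act acts (sd_act act acts v q) p"
      if "p \<in> sd_carrier sg" "q \<in> sd_carrier sg" for v p q
      using that unfolding right_sd_module_def right_lie_module_def by blast
    show ?R
    proof (intro allI ballI)
      fix v j t assume "t \<in> {1..N}"
      then have t: "\<theta> t \<in> dual_space sg" by (rule dual_mem)
      have c0: "coad br 0 0 = 0" by (simp add: coad_def fun_eq_iff)
      show "acts (act v (X j)) (\<theta> t) = acts v (coad br (X j) (\<theta> t)) + act (acts v (\<theta> t)) (X j)"
        using L[of "(0, X j)" "(\<theta> t, 0)" v] t d0
        by (simp add: sd_carrier_def sd_act_def sd_bracket_def c0 A0 S0 br0)
    qed
  next
    assume R: ?R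
    define Q where "Q v x \<alpha> \<longleftrightarrow> acts (act v x) \<alpha> = acts v (coad br x \<alpha>) + act (acts v \<alpha>) x" for v x \<alpha>
    have Qx: "Q v x \<alpha> \<Longrightarrow> Q v y \<alpha> \<Longrightarrow> Q v (x + y) \<alpha>" "Q v x \<alpha> \<Longrightarrow> Q v (sg c x) \<alpha>" "Q v 0 \<alpha>"
      if a: "\<alpha> \<in> dual_space sg" for v x y c \<alpha>
    proof -
      have c: "coad br (x + y) \<alpha> = coad br x \<alpha> + coad br y \<alpha>" "coad br (sg c x) \<alpha> = (\<lambda>z. c * coad br x \<alpha> z)" "coad br 0 \<alpha> = 0"
        by (simp_all add: coad_def fun_eq_iff br br0 dlin[OF a])
      show "Q v x \<alpha> \<Longrightarrow> Q v y \<alpha> \<Longrightarrow> Q v (x + y) \<alpha>" "Q v x \<alpha> \<Longrightarrow> Q v (sg c x) \<alpha>" "Q v 0 \<alpha>"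
        by (simp_all add: Q_def c A A0 S0 a dco S V.scale_right_distrib algebra_simps)
    qed
    have Qa: "Q v x \<alpha> \<Longrightarrow> Q v x \<beta> \<Longrightarrow> Q v x (\<alpha> + \<beta>)" "Q v x \<alpha> \<Longrightarrow> Q v x (\<lambda>z. c * \<alpha> z)" "Q v x 0"
      if a: "\<alpha> \<in> dual_space sg" "\<beta> \<in> dual_space sg" for v x c \<alpha> \<beta>
    proof -
      have c: "coad br x (\<alpha> + \<beta>) = coad br x \<alpha> + coad br x \<beta>" "coad br x (\<lambda>z. c * \<alpha> z) = (\<lambda>z. c * coad br x \<alpha> z)" "coad br x 0 = 0"
        by (simp_all add: coad_def fun_eq_iff)
      show "Q v x \<alpha> \<Longrightarrow> Q v x \<beta> \<Longrightarrow> Q v x (\<alpha> + \<beta>)" "Q v x \<alpha> \<Longrightarrow> Q v x (\<lambda>z. c * \<alpha> z)" "Q v x 0"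
        by (simp_all add: Q_def c A A0 S0 a dco S V.scale_right_distrib algebra_simps)
    qed
    have Q1: "Q v x (\<theta> t)" if t: "t \<in> {1..N}" for v x t
    proof -
      have "Q v (\<Sum>i\<in>I. sg (\<theta> i x) (X i)) (\<theta> t)" if "I \<subseteq> {1..N}" for I
        using that
      proof (induction I rule: infinite_finite_induct)
        case (insert i I)
        have "Q v (X i) (\<theta> t)" using R t insert.prems by (auto simp: Q_def)
        then show ?case using insert Qx[OF dual_mem[OF t]] by simp
      qed (simp_all add: Qx[OF dual_mem[OF t]])
      from this[OF subset_refl] show ?thesis using expansion[of x] by simp
    qed
    have Q2: "Q v x \<alpha>" if a: "\<alpha> \<in> dual_space sg" for v x \<alpha>
    proof -
      have "(\<Sum>i\<in>I. (\<lambda>z. \<alpha> (X i) * \<theta> i z)) \<in> dual_space sg \<and> Q v x (\<Sum>i\<in>I. (\<lambda>z. \<alpha> (X i) * \<theta> i z))" if "I \<subseteq> {1..N}" for I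
        using that
      proof (induction I rule: infinite_finite_induct)
        case (insert i I)
        have i: "\<theta> i \<in> dual_space sg" "Q v x (\<theta> i)" using insert.prems dual_mem Q1 by auto
        have I: "(\<Sum>i\<in>I. (\<lambda>z. \<alpha> (X i) * \<theta> i z)) \<in> dual_space sg" "Q v x (\<Sum>i\<in>I. (\<lambda>z. \<alpha> (X i) * \<theta> i z))"
          using insert.IH insert.prems by auto
        show ?case unfolding sum.insert[OF insert.hyps]
          using dadd[OF dsc[OF i(1)] I(1)] Qa(1)[OF dsc[OF i(1)] I(1) Qa(2)[OF i(1) i(1) i(2)] I(2)] by blast
      qed (simp_all only: sum.infinite sum.empty d0 Qa(3)[OF d0 d0] not_False_eq_True simp_thms)
      from this[OF subset_refl] have "Q v x (\<Sum>i=1..N. (\<lambda>z. \<alpha> (X i) * \<theta> i z))" by blast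
      moreover have "(\<Sum>i=1..N. (\<lambda>z. \<alpha> (X i) * \<theta> i z)) = \<alpha>"
      proof
        fix z
        interpret a: Vector_Spaces.linear sg "(*)" \<alpha> using a by (simp add: dual_space_def)
        have "\<alpha> z = \<alpha> (\<Sum>i=1..N. sg (\<theta> i z) (X i))" using expansion[of z] by simp
        then show "(\<Sum>i=1..N. (\<lambda>z. \<alpha> (X i) * \<theta> i z)) z = \<alpha> z"
          by (simp add: sum_fun_apply a.sum a.scale mult.commute)
      qed
      ultimately show ?thesis by simp
    qed
    have R': "acts (act v x) \<alpha> = acts v (coad br x \<alpha>) + act (acts v \<alpha>) x" if "\<alpha> \<in> dual_space sg" for v x \<alpha>
      using Q2[OF that] by (simp add: Q_def)
    have lin: "Vector_Spaces.linear sv sv (\<lambda>v. sd_act act acts v p)" if "p \<in> sd_carrier sg" for p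
      using that V.vector_space_axioms
      by (auto simp: Vector_Spaces.linear_iff sd_act_def sd_carrier_def A S V.scale_right_distrib algebra_simps)
    have comm: "acts (acts v \<alpha>) \<beta> = acts (acts v \<beta>) \<alpha>" if "\<alpha> \<in> dual_space sg" "\<beta> \<in> dual_space sg" for v \<alpha> \<beta>
      by (rule S(5)[OF that])
    have brk: "sd_act act acts v (sd_bracket br (\<alpha>, x) (\<beta>, y)) =
        sd_act act acts (sd_act act acts v (\<alpha>, x)) (\<beta>, y) - sd_act act acts (sd_act act acts v (\<beta>, y)) (\<alpha>, x)"
      if a: "\<alpha> \<in> dual_space sg" and b: "\<beta> \<in> dual_space sg" for v \<alpha> \<beta> x y
      using comm[OF a b, of v]
      by (simp add: sd_act_def sd_bracket_def Sd[OF dco[OF b] dco[OF a]] A S[OF a] S[OF b] R'[OF a] R'[OF b])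
    show ?L unfolding right_sd_module_def right_lie_module_def
      using V.vector_space_axioms lin brk
      by (auto simp: sd_carrier_def sd_act_def sd_scale_def A S V.scale_right_distrib)
  qed
qed

end

theory Submission
  imports Defs
begin

text \<open>Every element of \<open>\<And>\<gg>* \<otimes> V\<close> is a sum of pure tensors \<open>\<beta> \<otimes> v\<close>, so it suffices to compute
  \<open>D\<^sup>2 = d_CE\<^sup>2 + d_K\<^sup>2 + (d_CE d_K + d_K d_CE)\<close> on these. The first two terms vanish without any
  compatibility between the two actions: \<open>d_CE\<^sup>2 = 0\<close> because \<open>d_dR\<^sup>2 = 0\<close> (the Jacobi identity, \<open>d_d\<close>) and
  \<open>V\<close> is a \<open>\<gg>\<close>-module (\<open>dCE_dCE\<close>), and \<open>d_K\<^sup>2 = 0\<close> because contractions anticommute while the elements of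
  \<open>\<gg>*\<close> act by commuting operators (\<open>dK_dK\<close>).

  The mixed term is governed by Cartan's formula \<open>cartan\<close>, which says that \<open>d_dR \<iota>_X + \<iota>_X d_dR\<close> is the
  derivation extending the coadjoint action of \<open>X\<close>, and by
  \<open>\<iota>_i (\<theta>_j \<and> \<beta>) = \<delta>_ij \<beta> - \<theta>_j \<and> \<iota>_i \<beta>\<close>. Collecting terms (\<open>D_D_tensor\<close>),
  \<open>D\<^sup>2 (\<beta> \<otimes> v) = - (\<Sum>j t. \<theta>_j \<and> \<iota>_t \<beta> \<otimes> E_jt v) - \<beta> \<otimes> (\<Sum>k. (v \<cdot> X_k) \<lhd> \<theta>_k)\<close> where
  \<open>E_jt v = v \<lhd> (X_j \<rhd> \<theta>_t) + (v \<lhd> \<theta>_t) \<cdot> X_j - (v \<cdot> X_j) \<lhd> \<theta>_t\<close>. Both conditions together make this zero.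
  Conversely \<open>\<beta> = 1\<close> isolates unimodular stability, and then \<open>\<beta> = \<theta>_s\<close> leaves
  \<open>\<Sum>j. \<theta>_j \<otimes> E_js v = 0\<close>, whose coefficients are the defects \<open>E_js v\<close> of the module law over \<open>\<gg>* \<rtimes> \<gg>\<close>.\<close>

section \<open>Exterior algebra\<close>

text \<open>Forms are functions, but they are manipulated as elements of an algebra: evaluation at an index
  set is unfolded on demand only.\<close>

lemmas pointwise = plus_fun_apply zero_fun_apply times_fun_apply minus_apply uminus_apply

declare pointwise [simp del]

text \<open>The space \<open>\<And>\<gg>*\<close> is spanned by the elements obtained from \<open>1\<close> by multiplying with generators on the
  left. Identities between linear operators built from \<open>d_dR\<close> and the contractions are proved this way,
  the step \<open>gen\<close> being the derivation rule.\<close>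

lemma exterior_induct [consumes 1, case_names unit gen add scale]:
  assumes "\<beta> \<in> W N"
    and unit: "P (mono_form {})"
    and gen: "\<And>i \<beta>. i \<in> {1..N} \<Longrightarrow> \<beta> \<in> W N \<Longrightarrow> P \<beta> \<Longrightarrow> P (gen i \<^bold>\<and> \<beta>)"
    and add: "\<And>\<alpha> \<beta>. \<alpha> \<in> W N \<Longrightarrow> \<beta> \<in> W N \<Longrightarrow> P \<alpha> \<Longrightarrow> P \<beta> \<Longrightarrow> P (\<alpha> + \<beta>)"
    and scale: "\<And>c \<alpha>. \<alpha> \<in> W N \<Longrightarrow> P \<alpha> \<Longrightarrow> P (escale c \<alpha>)"
  shows "P \<beta>"
proof -
  have mono: "P (mono_form S)" if "S \<subseteq> {1..N}" for S
    using that
  proof (induction "card S" arbitrary: S rule: less_induct)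
    case less
    have fin: "finite S" using less.prems by (meson finite_atLeastAtMost finite_subset)
    show ?case
    proof (cases "S = {}")
      case False
      have i: "Min S \<in> S" using fin False by simp
      then have "card (S - {Min S}) < card S" using fin by (simp add: card_gt_0_iff False)
      then have "P (mono_form (S - {Min S}))" using less.hyps less.prems by blast
      moreover have "Min S \<in> {1..N}" "mono_form (S - {Min S}) \<in> W N"
        using i less.prems by (auto intro!: mono_form_W(1))
      ultimately show ?thesis using gen mono_form_gen_Min[OF fin False] by simp
    qed (simp add: unit)
  qed
  have "(\<Sum>S\<in>A. escale (\<beta> S) (mono_form S)) \<in> W N \<and> P (\<Sum>S\<in>A. escale (\<beta> S) (mono_form S))"
    if "A \<subseteq> Pow {1..N}" for A
    using that
  proof (induction A rule: infinite_finite_induct)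
    case (insert S A)
    then have S: "escale (\<beta> S) (mono_form S) \<in> W N" "P (escale (\<beta> S) (mono_form S))"
      by (auto intro!: W_escale mono_form_W(1) scale mono simp del: One_nat_def)
    then show ?case unfolding sum.insert[OF insert.hyps] using insert W_add add by auto
  next
    case empty
    have "escale 0 (mono_form {}) = 0" by (auto simp: escale_def fun_eq_iff pointwise)
    then have "P 0" using scale[OF mono_form_W(1)[of "{}"] unit, of 0] by simp
    then show ?case using W_zero by simp
  qed (use finite_subset in \<open>auto simp del: One_nat_def\<close>)
  from this[OF subset_refl] show ?thesis using mono_form_expansion[OF assms(1)] by simp
qed

lemma gen_W: "i \<in> {1..N} \<Longrightarrow> gen i \<in> W N" "i \<in> {1..N} \<Longrightarrow> gen i \<in> W_deg N 1"
  using mono_form_W[of "{i}" N] by auto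

lemma gen_wedge_W: "i \<in> {1..N} \<Longrightarrow> \<beta> \<in> W N \<Longrightarrow> gen i \<^bold>\<and> \<beta> \<in> W N"
  by (rule wedge_W[OF gen_W(1)])

lemma unit_W: "mono_form {} \<in> W N" "mono_form {} \<in> W_deg N 0"
  using mono_form_W[of "{}" N] by auto

lemma escale_minus_one: "escale (- 1) \<alpha> = - \<alpha>"
  by (auto simp: escale_def fun_eq_iff pointwise)

lemma escale_one: "escale 1 \<alpha> = \<alpha>"
  by (auto simp: escale_def fun_eq_iff pointwise)

lemma escale_null: "escale 0 \<alpha> = 0"
  by (auto simp: escale_def fun_eq_iff pointwise)

lemma escale_add_left: "escale (c + d) \<alpha> = escale c \<alpha> + escale d \<alpha>"
  by (simp add: escale_def fun_eq_iff pointwise distrib_right)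

lemma escale_minus: "escale c (- \<alpha>) = - escale c \<alpha>" "escale (- c) \<alpha> = - escale c \<alpha>"
  by (auto simp: escale_def fun_eq_iff pointwise)

lemma escale_diff: "escale c (\<alpha> - \<beta>) = escale c \<alpha> - escale c \<beta>"
  using escale_add[of c \<alpha> "- \<beta>"] by (simp add: escale_minus)

lemma escale_escale: "escale c (escale d \<alpha>) = escale (c * d) \<alpha>"
  by (auto simp: escale_def fun_eq_iff pointwise)

lemma wedge_minus: "(- \<alpha>) \<^bold>\<and> \<beta> = - (\<alpha> \<^bold>\<and> \<beta>)" "\<alpha> \<^bold>\<and> (- \<beta>) = - (\<alpha> \<^bold>\<and> \<beta>)"
  by (simp_all flip: escale_minus_one add: wedge_escale_left wedge_escale_right)

lemma wedge_diff_right: "\<alpha> \<^bold>\<and> (\<beta> - \<gamma>) = \<alpha> \<^bold>\<and> \<beta> - \<alpha> \<^bold>\<and> \<gamma>"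
  using wedge_add_right[of \<alpha> \<beta> "- \<gamma>"] by (simp add: wedge_minus)

lemma W_minus:
  fixes \<alpha> :: "nat set \<Rightarrow> 'v::ab_group_add"
  shows "\<alpha> \<in> W N \<Longrightarrow> - \<alpha> \<in> W N"
  by (auto simp: W_def pointwise)

lemma W_diff:
  fixes \<alpha> :: "nat set \<Rightarrow> 'v::ab_group_add"
  shows "\<alpha> \<in> W N \<Longrightarrow> \<beta> \<in> W N \<Longrightarrow> \<alpha> - \<beta> \<in> W N"
  using W_add[of \<alpha> N "- \<beta>"] W_minus by auto

lemma gen_anticommute: "gen i \<^bold>\<and> gen j = - (gen j \<^bold>\<and> gen i)"
proof (cases "i = j")
  case True
  have "(gen i \<^bold>\<and> gen i) U = 0" for U
    unfolding wedge_def by (rule sum.neutral) (auto simp: mono_form_def)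
  then show ?thesis using True by (simp add: fun_eq_iff pointwise)
next
  case False
  have "shuffle_sign {i} {j} * shuffle_sign {j} {i} = - 1"
    using shuffle_sign_swap[of "{i}" "{j}"] False by simp
  then have "shuffle_sign {i} {j} = - shuffle_sign {j} {i}"
    by (metis mult.assoc mult.right_neutral mult_minus1 shuffle_sign_square)
  then show ?thesis using False
    by (simp add: mono_form_wedge escale_minus insert_commute)
qed

lemma gen_anticommute_assoc: "gen i \<^bold>\<and> (gen j \<^bold>\<and> \<beta>) = - (gen j \<^bold>\<and> (gen i \<^bold>\<and> \<beta>))"
  by (metis gen_anticommute wedge_assoc wedge_minus(1))

lemma contract_add: "contract N \<theta> x (\<alpha> + \<beta>) = contract N \<theta> x \<alpha> + contract N \<theta> x \<beta>"
  by (simp add: contract_pcontract pcontract_add escale_add sum.distrib)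

lemma contract_escale: "contract N \<theta> x (escale c \<alpha>) = escale c (contract N \<theta> x \<alpha>)"
  by (simp add: contract_pcontract pcontract_escale escale_sum escale_escale mult.commute)

lemma contract_zero: "contract N \<theta> x 0 = 0"
  using contract_add[of N \<theta> x 0 0] by simp

lemma contract_minus: "contract N \<theta> x (- \<alpha>) = - contract N \<theta> x \<alpha>"
  by (simp flip: escale_minus_one add: contract_escale)

lemma contract_diff: "contract N \<theta> x (\<alpha> - \<beta>) = contract N \<theta> x \<alpha> - contract N \<theta> x \<beta>"
  using contract_add[of N \<theta> x \<alpha> "- \<beta>"] by (simp add: contract_minus)

lemma contract_sum: "contract N \<theta> x (\<Sum>i\<in>A. f i) = (\<Sum>i\<in>A. contract N \<theta> x (f i))"
  by (induction A rule: infinite_finite_induct)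
    (simp_all only: sum.infinite sum.empty sum.insert contract_add contract_zero not_False_eq_True simp_thms)

lemma contract_W: "\<beta> \<in> W N \<Longrightarrow> contract N \<theta> x \<beta> \<in> W N"
  unfolding contract_pcontract by (intro W_sum W_escale(1) pcontract_W)

lemma contract_unit: "contract N \<theta> x (mono_form {}) = 0"
  unfolding contract_def by (rule ext) (auto simp: mono_form_def pointwise)

lemma contract_gen_wedge:
  assumes "i \<in> {1..N}" "\<beta> \<in> W N"
  shows "contract N \<theta> x (gen i \<^bold>\<and> \<beta>) = escale (\<theta> i x) \<beta> - gen i \<^bold>\<and> contract N \<theta> x \<beta>"
  using contract_antiderivation[OF gen_W(2)[OF assms(1)], of \<theta> x \<beta>]
  by (simp add: contract_gen[OF assms(1)] wedge_escale_left wedge_unit[OF assms(2)] escale_minus_one)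

lemma contract_anticommute:
  assumes "\<beta> \<in> W N"
  shows "contract N \<theta> x (contract N \<theta> y \<beta>) = - contract N \<theta> y (contract N \<theta> x \<beta>)"
  using assms
proof (induction rule: exterior_induct)
  case (gen i \<beta>)
  then show ?case
    by (simp add: contract_gen_wedge contract_W contract_diff contract_escale wedge_minus)
qed (simp_all add: contract_unit contract_zero contract_add contract_escale escale_minus)

lemma sum3_cyclic:
  fixes f :: "nat \<Rightarrow> nat \<Rightarrow> nat \<Rightarrow> 'a::comm_monoid_add"
  shows "(\<Sum>i\<in>A. \<Sum>j\<in>A. \<Sum>k\<in>A. f i j k) = (\<Sum>i\<in>A. \<Sum>j\<in>A. \<Sum>k\<in>A. f j k i)"
proof -
  have "(\<Sum>i\<in>A. \<Sum>j\<in>A. \<Sum>k\<in>A. f j k i) = (\<Sum>j\<in>A. \<Sum>i\<in>A. \<Sum>k\<in>A. f j k i)"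
    by (rule sum.swap)
  also have "\<dots> = (\<Sum>j\<in>A. \<Sum>k\<in>A. \<Sum>i\<in>A. f j k i)"
    by (intro sum.cong sum.swap refl)
  finally show ?thesis by simp
qed


section \<open>The de Rham differential of a Lie algebra\<close>

text \<open>A Lie algebra with dual bases, and its structure constants. Here \<open>\<iota> i\<close> is contraction with the basis
  vector \<open>X i\<close>.\<close>

locale lie_algebra_basis = complex_lie_algebra sg br + dual_bases sg N X \<theta>
  for sg :: "complex \<Rightarrow> 'g::ab_group_add \<Rightarrow> 'g" and br :: "'g \<Rightarrow> 'g \<Rightarrow> 'g"
    and N :: nat and X :: "nat \<Rightarrow> 'g" and \<theta> :: "nat \<Rightarrow> 'g \<Rightarrow> complex"
begin

abbreviation "C \<equiv> struct_const br X \<theta>"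
abbreviation "d \<equiv> dR N C"
abbreviation "\<iota> i \<equiv> contract N \<theta> (X i)"

lemma dual_add: "i \<in> {1..N} \<Longrightarrow> \<theta> i (x + y) = \<theta> i x + \<theta> i y"
  and dual_scale: "i \<in> {1..N} \<Longrightarrow> \<theta> i (sg c x) = c * \<theta> i x"
  using dual_mem[of i] by (simp_all add: dual_space_def Vector_Spaces.linear_iff)

lemma dual_sum:
  assumes "i \<in> {1..N}"
  shows "\<theta> i (\<Sum>j\<in>A. f j) = (\<Sum>j\<in>A. \<theta> i (f j))"
proof -
  interpret t: Vector_Spaces.linear sg "(*)" "\<theta> i" using dual_mem[OF assms] by (simp add: dual_space_def)
  show ?thesis by (rule t.sum)
qed

lemma br_antisym: "br x y = - br y x"
proof -
  have add: "br (x + x') y = br x y + br x' y" "br x (y + y') = br x y + br x y'" for x x' y y'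
    using linear_left linear_right by (simp_all add: Vector_Spaces.linear_iff)
  have "br (x + y) (x + y) = br x y + br y x" unfolding add by (simp add: alternating[of x] alternating[of y])
  then have "br x y + br y x = 0" by (simp only: alternating)
  then show ?thesis by (simp only: eq_neg_iff_add_eq_0)
qed

lemma C_antisym: "i \<in> {1..N} \<Longrightarrow> C i j k = - C i k j"
  using dual_scale[of i "- 1" "br (X k) (X j)"] br_antisym[of "X j" "X k"]
  by (simp add: struct_const_def)

lemma C_jacobi:
  assumes i: "i \<in> {1..N}"
  shows "(\<Sum>j=1..N. C i j k * C j l m) + (\<Sum>j=1..N. C i j l * C j m k) + (\<Sum>j=1..N. C i j m * C j k l) = 0"
proof -
  have *: "(\<Sum>j=1..N. C i j k * C j l m) = \<theta> i (br (br (X l) (X m)) (X k))" for k l m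
  proof -
    interpret b: Vector_Spaces.linear sg sg "\<lambda>x. br x (X k)" by (rule linear_left)
    show ?thesis unfolding bracket_basis[of br l m]
      by (simp add: b.sum b.scale dual_sum[OF i] dual_scale[OF i] struct_const_def mult.commute)
  qed
  have "br (br (X l) (X m)) (X k) + br (br (X m) (X k)) (X l) + br (br (X k) (X l)) (X m) =
      - (br (X l) (br (X m) (X k)) + br (X m) (br (X k) (X l)) + br (X k) (br (X l) (X m)))"
    using br_antisym[of "br (X l) (X m)" "X k"] br_antisym[of "br (X m) (X k)" "X l"]
      br_antisym[of "br (X k) (X l)" "X m"] by simp
  also have "\<dots> = 0" by (simp only: jacobi neg_equal_0_iff_equal)
  finally have "\<theta> i (br (br (X l) (X m)) (X k) + br (br (X m) (X k)) (X l) + br (br (X k) (X l)) (X m)) = \<theta> i 0"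
    by simp
  then show ?thesis unfolding * dual_add[OF i] using dual_scale[OF i, of 0 0] by simp
qed

lemmas d_add = is_dRD(1)[OF dR_is_dR[of N C]]
  and d_escale = is_dRD(2)[OF dR_is_dR[of N C]]
  and d_deg = is_dRD(3)[OF dR_is_dR[of N C]]
  and d_leibniz = is_dRD(4)[OF dR_is_dR[of N C]]
  and d_gen = is_dRD(5)[OF dR_is_dR[of N C]]

lemma d_zero: "d 0 = 0"
  using d_add[OF W_zero(1) W_zero(1)] by simp

lemma d_minus: "\<alpha> \<in> W N \<Longrightarrow> d (- \<alpha>) = - d \<alpha>"
  using d_escale[of \<alpha> "- 1"] by (simp add: escale_minus_one)

lemma d_diff: "\<alpha> \<in> W N \<Longrightarrow> \<beta> \<in> W N \<Longrightarrow> d (\<alpha> - \<beta>) = d \<alpha> - d \<beta>"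
  using d_add[of \<alpha> "- \<beta>"] by (simp add: d_minus W_minus)

lemma d_sum: "(\<And>i. i \<in> A \<Longrightarrow> f i \<in> W N) \<Longrightarrow> d (\<Sum>i\<in>A. f i) = (\<Sum>i\<in>A. d (f i))"
proof (induction A rule: infinite_finite_induct)
  case (insert i A)
  then show ?case unfolding sum.insert[OF insert.hyps] by (subst d_add) (auto intro!: W_sum)
qed (simp_all only: sum.infinite sum.empty d_zero not_False_eq_True simp_thms)

lemma d_unit: "d (mono_form {}) = 0"
proof -
  have "d (mono_form {}) \<in> W N" using d_deg[OF unit_W(2)] W_deg_subset by blast
  then show ?thesis
    using d_leibniz[OF unit_W(2) unit_W(1)] by (simp add: wedge_unit unit_W escale_one)
qed

lemma d_gen_W: "i \<in> {1..N} \<Longrightarrow> d (gen i) \<in> W_deg N 2" "i \<in> {1..N} \<Longrightarrow> d (gen i) \<in> W N"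
  using d_deg[OF gen_W(2)] W_deg_subset[of N 2] by (fastforce simp: numeral_2_eq_2)+

lemma d_gen_wedge:
  "i \<in> {1..N} \<Longrightarrow> \<beta> \<in> W N \<Longrightarrow> d (gen i \<^bold>\<and> \<beta>) = d (gen i) \<^bold>\<and> \<beta> - gen i \<^bold>\<and> d \<beta>"
  using d_leibniz[OF gen_W(2)] by (simp add: escale_minus_one)

lemma d_W: "\<beta> \<in> W N \<Longrightarrow> d \<beta> \<in> W N"
proof (induction rule: exterior_induct)
  case (gen i \<beta>)
  then show ?case by (simp only: d_gen_wedge) (intro W_diff wedge_W d_gen_W gen_W)
qed (simp_all add: d_unit W_zero d_add d_escale W_add W_escale)

text \<open>The second differential of \<open>\<theta>_i\<close> is a combination of the products \<open>\<theta>_l \<and> \<theta>_m \<and> \<theta>_k\<close>, with coefficients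
  quadratic in the structure constants. The products are invariant under cyclic permutation of
  \<open>l, m, k\<close>, and by the Jacobi identity the coefficients have cyclic sum zero.\<close>

lemma d_d_gen:
  assumes i: "i \<in> {1..N}"
  shows "d (d (gen i)) = 0"
proof -
  let ?I = "{1..N}"
  have W2: "gen j \<^bold>\<and> gen k \<in> W N" if "j \<in> ?I" "k \<in> ?I" for j k
    using that by (intro wedge_W gen_W)
  have "d (d (gen i)) = escale (- 1 / 2) (\<Sum>j\<in>?I. \<Sum>k\<in>?I. escale (C i j k) (d (gen j \<^bold>\<and> gen k)))"
  proof -
    have "d (\<Sum>j\<in>?I. \<Sum>k\<in>?I. escale (C i j k) (gen j \<^bold>\<and> gen k)) =
        (\<Sum>j\<in>?I. \<Sum>k\<in>?I. escale (C i j k) (d (gen j \<^bold>\<and> gen k)))"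
    proof -
      have "d (\<Sum>k\<in>?I. escale (C i j k) (gen j \<^bold>\<and> gen k)) =
          (\<Sum>k\<in>?I. escale (C i j k) (d (gen j \<^bold>\<and> gen k)))" if "j \<in> ?I" for j
        by (subst d_sum) (use that in \<open>auto intro!: sum.cong W_escale W2 d_escale simp del: One_nat_def atLeastAtMost_iff\<close>)
      then show ?thesis
        by (subst d_sum) (auto intro!: sum.cong W_sum W_escale W2 simp del: One_nat_def atLeastAtMost_iff)
    qed
    moreover have "(\<Sum>j\<in>?I. \<Sum>k\<in>?I. escale (C i j k) (gen j \<^bold>\<and> gen k)) \<in> W N"
      by (intro W_sum W_escale W2)
    ultimately show ?thesis unfolding d_gen[OF i] by (subst d_escale) simp_all
  qed
  also have "(\<Sum>j\<in>?I. \<Sum>k\<in>?I. escale (C i j k) (d (gen j \<^bold>\<and> gen k))) =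
      (\<Sum>j\<in>?I. \<Sum>k\<in>?I. escale (C i j k) (d (gen j) \<^bold>\<and> gen k)) -
      (\<Sum>j\<in>?I. \<Sum>k\<in>?I. escale (C i j k) (d (gen k) \<^bold>\<and> gen j))"
    unfolding sum_subtractf[symmetric]
  proof (intro sum.cong refl)
    fix j k assume jk: "j \<in> ?I" "k \<in> ?I"
    have "gen j \<^bold>\<and> d (gen k) = d (gen k) \<^bold>\<and> gen j"
      by (rule wedge_even_commute[OF d_gen_W(1)[OF jk(2)], symmetric])
    then show "escale (C i j k) (d (gen j \<^bold>\<and> gen k)) =
        escale (C i j k) (d (gen j) \<^bold>\<and> gen k) - escale (C i j k) (d (gen k) \<^bold>\<and> gen j)"
      using d_gen_wedge[OF jk(1) gen_W(1)[OF jk(2)]] by (simp only: escale_diff)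
  qed
  also have "(\<Sum>j\<in>?I. \<Sum>k\<in>?I. escale (C i j k) (d (gen k) \<^bold>\<and> gen j)) =
      - (\<Sum>j\<in>?I. \<Sum>k\<in>?I. escale (C i j k) (d (gen j) \<^bold>\<and> gen k))"
    unfolding sum_negf[symmetric] 
    by (subst sum.swap) (intro sum.cong refl, subst C_antisym[OF i], simp only: escale_minus)
  also have "(\<Sum>j\<in>?I. \<Sum>k\<in>?I. escale (C i j k) (d (gen j) \<^bold>\<and> gen k)) = 0"
  proof -
    define G where "G l m k = gen l \<^bold>\<and> (gen m \<^bold>\<and> gen k)" for l m k
    define a where "a l m k = (\<Sum>j\<in>?I. C i j k * C j l m)" for l m k
    have cyc: "G m k l = G l m k" for l m k
      unfolding G_def by (metis gen_anticommute gen_anticommute_assoc minus_minus wedge_minus(2))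
    have "(\<Sum>j\<in>?I. \<Sum>k\<in>?I. escale (C i j k) (d (gen j) \<^bold>\<and> gen k)) =
        (\<Sum>j\<in>?I. \<Sum>k\<in>?I. \<Sum>l\<in>?I. \<Sum>m\<in>?I. escale (- 1 / 2 * (C i j k * C j l m)) (G l m k))"
      by (intro sum.cong refl)
        (simp add: d_gen G_def wedge_escale_left wedge_sum_left escale_sum wedge_assoc escale_escale mult_ac)
    also have "\<dots> = (\<Sum>k\<in>?I. \<Sum>l\<in>?I. \<Sum>m\<in>?I. \<Sum>j\<in>?I. escale (- 1 / 2 * (C i j k * C j l m)) (G l m k))"
      by (subst sum.swap, rule sum.cong[OF refl], subst sum.swap, rule sum.cong[OF refl], rule sum.swap)
    also have "\<dots> = (\<Sum>k\<in>?I. \<Sum>l\<in>?I. \<Sum>m\<in>?I. escale (- 1 / 2 * a l m k) (G l m k))"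
      by (intro sum.cong refl) (auto simp: fun_eq_iff a_def pointwise sum_fun_apply escale_def sum_distrib_left sum_distrib_right)
    finally have s: "(\<Sum>j\<in>?I. \<Sum>k\<in>?I. escale (C i j k) (d (gen j) \<^bold>\<and> gen k)) =
        (\<Sum>k\<in>?I. \<Sum>l\<in>?I. \<Sum>m\<in>?I. escale (- 1 / 2 * a l m k) (G l m k))" (is "_ = ?T") .
    \<comment> \<open>Rewriting the three copies cyclically, the Jacobi identity applies termwise.\<close>
    have "?T + ?T + ?T = 0"
    proof -
      have T2: "?T = (\<Sum>k\<in>?I. \<Sum>l\<in>?I. \<Sum>m\<in>?I. escale (- 1 / 2 * a m k l) (G l m k))"
        by (subst sum3_cyclic) (simp only: cyc)
      have T3: "?T = (\<Sum>k\<in>?I. \<Sum>l\<in>?I. \<Sum>m\<in>?I. escale (- 1 / 2 * a k l m) (G l m k))"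
        unfolding T2 by (subst sum3_cyclic) (simp only: cyc)
      have "a l m k + a m k l + a k l m = 0" for l m k
        using C_jacobi[OF i, of k l m] by (simp add: a_def)
      moreover have "escale (- 1 / 2 * a l m k) (G l m k) + escale (- 1 / 2 * a m k l) (G l m k)
          + escale (- 1 / 2 * a k l m) (G l m k) = escale (- 1 / 2 * (a l m k + a m k l + a k l m)) (G l m k)" for l m k
        by (simp only: distrib_left escale_add_left)
      ultimately have z: "escale (- 1 / 2 * a l m k) (G l m k) + escale (- 1 / 2 * a m k l) (G l m k)
          + escale (- 1 / 2 * a k l m) (G l m k) = 0" for l m k
        by (simp add: escale_null)
      have "?T + ?T + ?T = ?T + (\<Sum>k\<in>?I. \<Sum>l\<in>?I. \<Sum>m\<in>?I. escale (- 1 / 2 * a m k l) (G l m k))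
          + (\<Sum>k\<in>?I. \<Sum>l\<in>?I. \<Sum>m\<in>?I. escale (- 1 / 2 * a k l m) (G l m k))"
        using T2 T3 by simp
      also have "\<dots> = 0" unfolding sum.distrib[symmetric] z by simp
      finally show ?thesis .
    qed
    moreover have "escale 3 ?T = ?T + ?T + ?T"
      using escale_add_left[of 1 1 ?T] escale_add_left[of 2 1 ?T] by (simp add: escale_one)
    ultimately have "escale (1 / 3) (escale 3 ?T) = 0" by (simp add: escale_zero)
    then show ?thesis unfolding s by (simp add: escale_escale escale_one)
  qed
  finally show ?thesis by (simp add: escale_zero)
qed

lemma d_d: "\<beta> \<in> W N \<Longrightarrow> d (d \<beta>) = 0"
proof (induction rule: exterior_induct)
  case (gen i \<beta>)
  have "d (d (gen i) \<^bold>\<and> \<beta>) = d (gen i) \<^bold>\<and> d \<beta>"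
    using d_leibniz[OF d_gen_W(1)[OF gen.hyps(1)] gen.hyps(2)]
    by (simp add: d_d_gen[OF gen.hyps(1)] wedge_zero_left escale_one)
  moreover have "d (gen i \<^bold>\<and> d \<beta>) = d (gen i) \<^bold>\<and> d \<beta>"
    using gen by (simp add: d_gen_wedge d_W wedge_zero_right)
  ultimately show ?case
    using gen by (simp add: d_gen_wedge d_diff wedge_W gen_wedge_W d_W d_gen_W)
qed (simp_all add: d_unit d_zero d_add d_escale d_W escale_zero)

lemma contract_basis_gen_wedge:
  assumes "i \<in> {1..N}" "s \<in> {1..N}" "\<beta> \<in> W N"
  shows "\<iota> i (gen s \<^bold>\<and> \<beta>) = (if s = i then \<beta> else 0) - gen s \<^bold>\<and> \<iota> i \<beta>"
  using assms by (simp add: contract_gen_wedge dual_pairing escale_one escale_null del: One_nat_def)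

text \<open>By Cartan's formula \<open>\<iota> i (d (gen t))\<close> is the Lie derivative of \<open>\<theta>_t\<close> along \<open>X i\<close>, here in coordinates.\<close>

lemma contract_d_gen:
  assumes i: "i \<in> {1..N}" and t: "t \<in> {1..N}"
  shows "\<iota> i (d (gen t)) = (\<Sum>k=1..N. escale (- C t i k) (gen k))"
proof -
  let ?I = "{1..N}"
  have g: "\<iota> i (gen j \<^bold>\<and> gen k) = (if j = i then gen k else 0) - (if k = i then gen j else 0)"
    if "j \<in> ?I" "k \<in> ?I" for j k
    using that i by (simp add: contract_basis_gen_wedge gen_W contract_gen dual_pairing wedge_escale_right
        wedge_unit[OF gen_W(1)[OF that(1)]] escale_one escale_null wedge_zero_right del: One_nat_def)
  have "\<iota> i (d (gen t)) = escale (- 1 / 2)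
      (\<Sum>j\<in>?I. \<Sum>k\<in>?I. escale (C t j k) ((if j = i then gen k else 0) - (if k = i then gen j else 0)))"
    unfolding d_gen[OF t] by (simp add: contract_escale contract_sum g del: One_nat_def)
  also have "(\<Sum>j\<in>?I. \<Sum>k\<in>?I. escale (C t j k) ((if j = i then gen k else 0) - (if k = i then gen j else 0)))
      = (\<Sum>j\<in>?I. \<Sum>k\<in>?I. if j = i then escale (C t j k) (gen k) else 0)
      - (\<Sum>j\<in>?I. \<Sum>k\<in>?I. if k = i then escale (C t j k) (gen j) else 0)"
    unfolding sum_subtractf[symmetric] by (intro sum.cong refl) (auto simp: escale_def fun_eq_iff pointwise)
  also have "(\<Sum>j\<in>?I. \<Sum>k\<in>?I. if k = i then escale (C t j k) (gen j) else 0) = (\<Sum>j\<in>?I. escale (C t j i) (gen j))"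
    using i by (simp del: One_nat_def)
  also have "\<dots> = - (\<Sum>j\<in>?I. escale (C t i j) (gen j))"
    unfolding sum_negf[symmetric] by (intro sum.cong refl, subst C_antisym[OF t]) (simp only: escale_minus)
  also have "(\<Sum>j\<in>?I. \<Sum>k\<in>?I. if j = i then escale (C t j k) (gen k) else 0) = (\<Sum>k\<in>?I. escale (C t i k) (gen k))"
    using i by (subst sum.swap) (simp del: One_nat_def)
  finally show ?thesis by (auto simp: fun_eq_iff escale_def sum_fun_apply sum_negf pointwise)
qed

text \<open>Cartan's formula. The Lie derivative of \<open>\<beta>\<close> along \<open>X i\<close> is the derivation determined by its values
  \<open>\<iota> i (d (gen t))\<close> on the generators.\<close>

lemma cartan:
  assumes i: "i \<in> {1..N}" and "\<beta> \<in> W N"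
  shows "d (\<iota> i \<beta>) + \<iota> i (d \<beta>) = (\<Sum>t=1..N. \<iota> i (d (gen t)) \<^bold>\<and> \<iota> t \<beta>)"
  using assms(2)
proof (induction rule: exterior_induct)
  case (gen s \<beta>)
  let ?L = "\<lambda>t. \<iota> i (d (gen t))"
  have anti: "?L t \<^bold>\<and> (gen s \<^bold>\<and> \<gamma>) = - (gen s \<^bold>\<and> (?L t \<^bold>\<and> \<gamma>))" if "t \<in> {1..N}" for t \<gamma>
  proof -
    have "gen k \<^bold>\<and> (gen s \<^bold>\<and> \<gamma>) = - (gen s \<^bold>\<and> (gen k \<^bold>\<and> \<gamma>))" for k by (rule gen_anticommute_assoc)
    then show ?thesis
      by (simp add: contract_d_gen[OF i that] wedge_sum_left wedge_sum_right wedge_escale_left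
          wedge_escale_right escale_minus sum_negf wedge_minus del: One_nat_def)
  qed
  have "\<iota> i (d (gen s) \<^bold>\<and> \<beta>) = ?L s \<^bold>\<and> \<beta> + d (gen s) \<^bold>\<and> \<iota> i \<beta>"
    using contract_antiderivation[OF d_gen_W(1)[OF gen.hyps(1)]] by (simp add: escale_one)
  then have "d (\<iota> i (gen s \<^bold>\<and> \<beta>)) + \<iota> i (d (gen s \<^bold>\<and> \<beta>)) =
      ?L s \<^bold>\<and> \<beta> + gen s \<^bold>\<and> (d (\<iota> i \<beta>) + \<iota> i (d \<beta>))"
    using gen.hyps i
    by (simp add: contract_basis_gen_wedge d_gen_wedge d_diff contract_diff d_W contract_W gen_wedge_W
        wedge_add_right d_zero W_zero d_minus del: One_nat_def)
  also have "\<dots> = (\<Sum>t=1..N. ?L t \<^bold>\<and> ((if s = t then \<beta> else 0) - gen s \<^bold>\<and> \<iota> t \<beta>))"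
  proof -
    have "(\<Sum>t=1..N. ?L t \<^bold>\<and> (if s = t then \<beta> else 0)) = (\<Sum>t=1..N. if s = t then ?L t \<^bold>\<and> \<beta> else 0)"
      by (intro sum.cong) (auto simp: wedge_zero_right)
    then show ?thesis using gen.hyps(1)
      by (simp add: gen.IH wedge_sum_right wedge_diff_right anti sum.distrib del: One_nat_def)
  qed
  also have "\<dots> = (\<Sum>t=1..N. ?L t \<^bold>\<and> \<iota> t (gen s \<^bold>\<and> \<beta>))"
    using gen.hyps by (simp add: contract_basis_gen_wedge del: One_nat_def)
  finally show ?case .
next
  case (add \<alpha> \<beta>)
  have "d (\<iota> i (\<alpha> + \<beta>)) + \<iota> i (d (\<alpha> + \<beta>)) = (d (\<iota> i \<alpha>) + \<iota> i (d \<alpha>)) + (d (\<iota> i \<beta>) + \<iota> i (d \<beta>))"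
    using add.hyps by (simp add: d_add contract_add contract_W d_W)
  then show ?case by (simp only: add.IH wedge_add_right contract_add sum.distrib)
next
  case (scale c \<alpha>)
  have "d (\<iota> i (escale c \<alpha>)) + \<iota> i (d (escale c \<alpha>)) = escale c (d (\<iota> i \<alpha>) + \<iota> i (d \<alpha>))"
    using scale.hyps by (simp add: d_escale contract_escale contract_W escale_add)
  then show ?case by (simp only: scale.IH escale_sum wedge_escale_right contract_escale)
qed (simp add: contract_unit d_unit d_zero contract_zero wedge_zero_right)

end


section \<open>The differentials on tensors\<close>

text \<open>The space \<open>V\<close> with its actions of \<open>\<gg>\<close> and of \<open>S(\<gg>*)\<close>, not assumed to be compatible.\<close>

locale lie_sym_bimodule = lie_algebra_basis sg br N X \<theta>
  for sg :: "complex \<Rightarrow> 'g::ab_group_add \<Rightarrow> 'g" and br :: "'g \<Rightarrow> 'g \<Rightarrow> 'g"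
    and N :: nat and X :: "nat \<Rightarrow> 'g" and \<theta> :: "nat \<Rightarrow> 'g \<Rightarrow> complex" +
  fixes sv :: "complex \<Rightarrow> 'v::ab_group_add \<Rightarrow> 'v" and act :: "'v \<Rightarrow> 'g \<Rightarrow> 'v"
    and acts :: "'v \<Rightarrow> ('g \<Rightarrow> complex) \<Rightarrow> 'v"
  assumes lie_module: "right_lie_module UNIV sg br sv act"
    and sym_module: "right_sym_module sg sv acts"
begin

sublocale V: vector_space sv
  using lie_module by (simp add: right_lie_module_def)

abbreviation ten :: "(nat set \<Rightarrow> complex) \<Rightarrow> 'v \<Rightarrow> nat set \<Rightarrow> 'v" (infixl "\<otimes>" 68)
  where "\<beta> \<otimes> v \<equiv> tensor sv \<beta> v"
abbreviation "dCE \<equiv> d_CE br N X \<theta> sv act"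
abbreviation "dK \<equiv> d_K N X \<theta> sv acts"
abbreviation "D \<equiv> d_total br N X \<theta> sv act acts"

lemma act_add: "act (v + w) x = act v x + act w x"
  and act_add_right: "act v (x + y) = act v x + act v y"
  and act_scale_right: "act v (sg c x) = sv c (act v x)"
  and act_bracket: "act v (br x y) = act (act v x) y - act (act v y) x"
  using lie_module by (auto simp: right_lie_module_def Vector_Spaces.linear_iff)

lemma dual_sym: "t \<in> {1..N} \<Longrightarrow> \<theta> t \<in> sym_algebra sg"
  by (rule sym_algebra.dual[OF dual_mem])

lemma acts_add: "t \<in> {1..N} \<Longrightarrow> acts (v + w) (\<theta> t) = acts v (\<theta> t) + acts w (\<theta> t)"
  using right_sym_moduleD(2)[OF sym_module dual_sym] by (simp add: Vector_Spaces.linear_iff)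

lemma acts_commute:
  assumes "s \<in> {1..N}" "t \<in> {1..N}"
  shows "acts (acts v (\<theta> s)) (\<theta> t) = acts (acts v (\<theta> t)) (\<theta> s)"
  using right_sym_moduleD(5)[OF sym_module dual_sym dual_sym, of _ _ v] assms by (metis mult.commute)

lemma act_sum_right: "finite A \<Longrightarrow> act v (\<Sum>i\<in>A. f i) = (\<Sum>i\<in>A. act v (f i))"
proof (induction A rule: finite_induct)
  case empty
  then show ?case using act_add_right[of v 0 0] by simp
qed (simp add: act_add_right)

lemma act_bracket_basis:
  "act (act v (X j)) (X k) - act (act v (X k)) (X j) = (\<Sum>i=1..N. sv (C i j k) (act v (X i)))"
  by (simp only: act_bracket[symmetric] bracket_basis[of br j k] act_sum_right[OF finite_atLeastAtMost] act_scale_right)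

lemma acts_coad:
  assumes t: "t \<in> {1..N}"
  shows "acts v (coad br (X j) (\<theta> t)) = - (\<Sum>k=1..N. sv (C t j k) (acts v (\<theta> k)))"
proof -
  have sum: "(\<Sum>k\<in>A. (\<lambda>_. c k) * \<theta> k) \<in> sym_algebra sg \<and>
      acts v (\<Sum>k\<in>A. (\<lambda>_. c k) * \<theta> k) = (\<Sum>k\<in>A. sv (c k) (acts v (\<theta> k)))"
    if "finite A" "A \<subseteq> {1..N}" for A c
    using that
  proof (induction A rule: finite_induct)
    case empty
    have "(\<lambda>_. 0) = (0 :: 'g \<Rightarrow> complex)" by (simp add: zero_fun_def)
    then show ?case using sym_algebra.const[of 0 sg] right_sym_moduleD(4)[OF sym_module, of v 0] by simp
  next
    case (insert k A)
    then have k: "k \<in> {1..N}" by auto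
    have 1: "(\<lambda>_. c k) * \<theta> k \<in> sym_algebra sg"
      by (intro sym_algebra.mult sym_algebra.const dual_sym k)
    have 2: "acts v ((\<lambda>_. c k) * \<theta> k) = sv (c k) (acts v (\<theta> k))"
      using right_sym_moduleD(5)[OF sym_module sym_algebra.const dual_sym[OF k], of v "c k"]
        right_sym_moduleD(5)[OF sym_module dual_sym[OF k] sym_algebra.const, of v "c k"]
      by (simp add: right_sym_moduleD(4)[OF sym_module] mult.commute)
    show ?case unfolding sum.insert[OF insert.hyps]
      using insert 1 2 right_sym_moduleD(3)[OF sym_module 1] sym_algebra.add[OF 1] by auto
  qed
  have "coad br (X j) (\<theta> t) = (\<Sum>k=1..N. (\<lambda>_. - C t j k) * \<theta> k)"
    unfolding coad_basis[OF linear_right t] by (rule ext) (simp add: sum_fun_apply sum_negf pointwise)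
  then show ?thesis using sum[of "{1..N}" "\<lambda>k. - C t j k"] by (simp add: sum_negf)
qed

lemma tensor_add_left: "(\<alpha> + \<beta>) \<otimes> v = \<alpha> \<otimes> v + \<beta> \<otimes> v"
  by (simp add: tensor_def fun_eq_iff pointwise V.scale_left_distrib)
lemma tensor_minus_left: "(- \<beta>) \<otimes> v = - (\<beta> \<otimes> v)"
  by (simp add: tensor_def fun_eq_iff pointwise)
lemma tensor_diff_left: "(\<alpha> - \<beta>) \<otimes> v = \<alpha> \<otimes> v - \<beta> \<otimes> v"
  by (simp add: tensor_def fun_eq_iff pointwise V.scale_left_diff_distrib)
lemma tensor_sum_left: "(\<Sum>i\<in>A. f i) \<otimes> v = (\<Sum>i\<in>A. f i \<otimes> v)"
  by (simp add: tensor_def fun_eq_iff sum_fun_apply V.scale_sum_left)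
lemma tensor_zero_left: "0 \<otimes> v = 0"
  by (simp add: tensor_def fun_eq_iff pointwise)
lemma tensor_add_right: "\<beta> \<otimes> (v + w) = \<beta> \<otimes> v + \<beta> \<otimes> w"
  by (simp add: tensor_def fun_eq_iff pointwise V.scale_right_distrib)
lemma tensor_minus_right: "\<beta> \<otimes> (- v) = - (\<beta> \<otimes> v)"
  by (simp add: tensor_def fun_eq_iff pointwise)
lemma tensor_diff_right: "\<beta> \<otimes> (v - w) = \<beta> \<otimes> v - \<beta> \<otimes> w"
  by (simp add: tensor_def fun_eq_iff pointwise V.scale_right_diff_distrib)
lemma tensor_sum_right: "\<beta> \<otimes> (\<Sum>i\<in>A. f i) = (\<Sum>i\<in>A. \<beta> \<otimes> f i)"
  by (simp add: tensor_def fun_eq_iff sum_fun_apply V.scale_sum_right)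
lemma tensor_zero_right: "\<beta> \<otimes> 0 = 0"
  by (simp add: tensor_def fun_eq_iff pointwise)
lemma tensor_escale: "escale c \<beta> \<otimes> v = \<beta> \<otimes> sv c v"
  by (simp add: tensor_def fun_eq_iff escale_def mult.commute)

lemma tensor_expansion:
  assumes "w \<in> W N"
  shows "w = (\<Sum>S\<in>Pow {1..N}. mono_form S \<otimes> w S)"
proof
  fix T
  have "(\<Sum>S\<in>Pow {1..N}. mono_form S \<otimes> w S) T = (\<Sum>S\<in>Pow {1..N}. if S = T then w S else 0)"
    unfolding sum_fun_apply by (intro sum.cong) (auto simp: tensor_def mono_form_def)
  also have "\<dots> = (if T \<in> Pow {1..N} then w T else 0)" by (rule sum.delta) simp
  also have "\<dots> = w T" using assms unfolding W_def by auto
  finally show "w T = (\<Sum>S\<in>Pow {1..N}. mono_form S \<otimes> w S) T" ..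
qed

lemma tensor_W: "\<beta> \<in> W N \<Longrightarrow> \<beta> \<otimes> v \<in> W N"
  by (auto simp: W_def tensor_def)

lemma tensor_lift_add:
  assumes "\<And>\<beta> v w. f \<beta> (v + w) = f \<beta> v + f \<beta> w"
  shows "tensor_lift N f (u + w) = tensor_lift N f u + tensor_lift N f w"
  by (simp add: tensor_lift_def assms pointwise sum.distrib)

lemma dCE_add: "dCE (u + w) = dCE u + dCE w"
  unfolding d_CE_def
  by (rule tensor_lift_add) (simp add: tensor_add_right act_add sum.distrib)

lemma dK_add: "dK (u + w) = dK u + dK w"
  unfolding d_K_def
  by (rule tensor_lift_add) (simp add: tensor_add_right acts_add sum.distrib del: One_nat_def)

lemma D_add: "D (u + w) = D u + D w"
  by (simp add: d_total_def dCE_add dK_add)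

lemma additive_rules:
  fixes F :: "(nat set \<Rightarrow> 'v) \<Rightarrow> nat set \<Rightarrow> 'v"
  assumes "\<And>u w. F (u + w) = F u + F w"
  shows "F 0 = 0" "F (u - w) = F u - F w" "F (sum f A) = (\<Sum>i\<in>A. F (f i))"
proof -
  interpret additive F by unfold_locales (rule assms)
  show "F 0 = 0" "F (u - w) = F u - F w" "F (sum f A) = (\<Sum>i\<in>A. F (f i))"
    by (rule zero diff sum)+
qed

lemmas dCE_linear = additive_rules[of dCE, OF dCE_add]
  and dK_linear = additive_rules[of dK, OF dK_add]
  and D_linear = additive_rules[of D, OF D_add]

lemma dCE_tensor: "\<beta> \<in> W N \<Longrightarrow> dCE (\<beta> \<otimes> v) = d \<beta> \<otimes> v - (\<Sum>i=1..N. (gen i \<^bold>\<and> \<beta>) \<otimes> act v (X i))"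
  by (rule d_CE_tensor[OF lie_module])

lemma dK_tensor: "\<beta> \<in> W N \<Longrightarrow> dK (\<beta> \<otimes> v) = (\<Sum>i=1..N. \<iota> i \<beta> \<otimes> acts v (\<theta> i))"
  by (rule d_K_tensor[OF sym_module dual_bases_axioms])

text \<open>Against an antisymmetric family of forms only the antisymmetric part of the coefficients counts.
  This turns the products of actions in \<open>d_CE\<^sup>2\<close> and \<open>d_K\<^sup>2\<close> into commutators.\<close>

lemma antisym_tensor_sum:
  assumes "\<And>i j. \<omega> j i = - \<omega> i j"
  shows "(\<Sum>i\<in>A. \<Sum>j\<in>A. \<omega> j i \<otimes> a i j) = (\<Sum>i\<in>A. \<Sum>j\<in>A. \<omega> i j \<otimes> sv (- 1 / 2) (a i j - a j i))"
proof -
  have "(\<Sum>i\<in>A. \<Sum>j\<in>A. \<omega> i j \<otimes> sv (1 / 2) (a j i)) = (\<Sum>i\<in>A. \<Sum>j\<in>A. \<omega> j i \<otimes> sv (1 / 2) (a i j))"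
    by (rule sum.swap)
  moreover have "\<omega> i j \<otimes> sv (- 1 / 2) (a i j - a j i) = \<omega> j i \<otimes> sv (1 / 2) (a i j) + \<omega> i j \<otimes> sv (1 / 2) (a j i)" for i j
    unfolding assms[of j i] tensor_minus_left
    by (simp add: V.scale_right_diff_distrib tensor_diff_right tensor_minus_right)
  moreover have "\<omega> j i \<otimes> a i j = \<omega> j i \<otimes> sv (1 / 2) (a i j) + \<omega> j i \<otimes> sv (1 / 2) (a i j)" for i j
    by (simp flip: tensor_add_right V.scale_left_distrib)
  ultimately show ?thesis by (simp add: sum.distrib)
qed

lemma dCE_dCE:
  assumes b: "\<beta> \<in> W N"
  shows "dCE (dCE (\<beta> \<otimes> v)) = 0"
proof -
  let ?I = "{1..N}"
  have "dCE (dCE (\<beta> \<otimes> v)) =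
      (\<Sum>i\<in>?I. \<Sum>j\<in>?I. (gen j \<^bold>\<and> (gen i \<^bold>\<and> \<beta>)) \<otimes> act (act v (X i)) (X j)) - (\<Sum>i\<in>?I. (d (gen i) \<^bold>\<and> \<beta>) \<otimes> act v (X i))"
    using b by (simp add: dCE_tensor dCE_linear d_W d_d tensor_zero_left gen_wedge_W d_gen_wedge tensor_diff_left
        sum_subtractf del: One_nat_def)
  also have "(\<Sum>i\<in>?I. (d (gen i) \<^bold>\<and> \<beta>) \<otimes> act v (X i)) =
      (\<Sum>i\<in>?I. \<Sum>j\<in>?I. \<Sum>k\<in>?I. (gen j \<^bold>\<and> (gen k \<^bold>\<and> \<beta>)) \<otimes> sv (- 1 / 2) (sv (C i j k) (act v (X i))))"
    by (intro sum.cong refl)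
      (simp add: d_gen wedge_escale_left wedge_sum_left wedge_assoc escale_sum tensor_sum_left tensor_escale mult.commute
        del: One_nat_def)
  also have "\<dots> = (\<Sum>j\<in>?I. \<Sum>k\<in>?I. \<Sum>i\<in>?I. (gen j \<^bold>\<and> (gen k \<^bold>\<and> \<beta>)) \<otimes> sv (- 1 / 2) (sv (C i j k) (act v (X i))))"
    by (subst sum.swap) (intro sum.cong refl sum.swap)
  also have "\<dots> = (\<Sum>j\<in>?I. \<Sum>k\<in>?I. (gen j \<^bold>\<and> (gen k \<^bold>\<and> \<beta>)) \<otimes>
      sv (- 1 / 2) (act (act v (X j)) (X k) - act (act v (X k)) (X j)))"
    unfolding act_bracket_basis V.scale_sum_right tensor_sum_right ..
  also have "\<dots> = (\<Sum>i\<in>?I. \<Sum>j\<in>?I. (gen j \<^bold>\<and> (gen i \<^bold>\<and> \<beta>)) \<otimes> act (act v (X i)) (X j))"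
    by (rule antisym_tensor_sum[symmetric]) (rule gen_anticommute_assoc)
  finally show ?thesis by simp
qed

lemma dK_dK:
  assumes b: "\<beta> \<in> W N"
  shows "dK (dK (\<beta> \<otimes> v)) = 0"
proof -
  let ?I = "{1..N}"
  have "dK (dK (\<beta> \<otimes> v)) = (\<Sum>i\<in>?I. \<Sum>j\<in>?I. \<iota> j (\<iota> i \<beta>) \<otimes> acts (acts v (\<theta> i)) (\<theta> j))"
    using b by (simp add: dK_tensor dK_linear contract_W)
  also have "\<dots> = (\<Sum>i\<in>?I. \<Sum>j\<in>?I. \<iota> i (\<iota> j \<beta>) \<otimes>
      sv (- 1 / 2) (acts (acts v (\<theta> i)) (\<theta> j) - acts (acts v (\<theta> j)) (\<theta> i)))"
    by (rule antisym_tensor_sum) (rule contract_anticommute[OF b])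
  also have "\<dots> = 0"
    by (intro sum.neutral ballI) (subst acts_commute, simp_all add: tensor_zero_right del: One_nat_def)
  finally show ?thesis .
qed

section \<open>The square of the total differential\<close>

text \<open>The failure of the module law over \<open>\<gg>* \<rtimes> \<gg>\<close> at the basis elements \<open>X j\<close> and \<open>\<theta> t\<close>.\<close>

definition defect :: "nat \<Rightarrow> nat \<Rightarrow> 'v \<Rightarrow> 'v" where
  "defect j t v = acts v (coad br (X j) (\<theta> t)) + act (acts v (\<theta> t)) (X j) - acts (act v (X j)) (\<theta> t)"

lemma D_D_tensor:
  assumes b: "\<beta> \<in> W N"
  shows "D (D (\<beta> \<otimes> v)) = - (\<Sum>j=1..N. \<Sum>t=1..N. (gen j \<^bold>\<and> \<iota> t \<beta>) \<otimes> defect j t v)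
    - \<beta> \<otimes> (\<Sum>i=1..N. acts (act v (X i)) (\<theta> i))"
proof -
  let ?I = "{1..N}"
  have "D (D (\<beta> \<otimes> v)) = dCE (dK (\<beta> \<otimes> v)) + dK (dCE (\<beta> \<otimes> v))"
    using dCE_dCE[OF b] dK_dK[OF b] by (simp add: d_total_def dCE_add dK_add)
  also have "dCE (dK (\<beta> \<otimes> v)) = (\<Sum>i\<in>?I. d (\<iota> i \<beta>) \<otimes> acts v (\<theta> i))
      - (\<Sum>i\<in>?I. \<Sum>j\<in>?I. (gen j \<^bold>\<and> \<iota> i \<beta>) \<otimes> act (acts v (\<theta> i)) (X j))"
    using b by (simp add: dK_tensor dCE_linear contract_W dCE_tensor sum_subtractf del: One_nat_def)
  also have "dK (dCE (\<beta> \<otimes> v)) = (\<Sum>i\<in>?I. \<iota> i (d \<beta>) \<otimes> acts v (\<theta> i))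
      - (\<Sum>j\<in>?I. \<Sum>i\<in>?I. \<iota> i (gen j \<^bold>\<and> \<beta>) \<otimes> acts (act v (X j)) (\<theta> i))"
    using b by (simp add: dCE_tensor dK_linear d_W dK_tensor gen_wedge_W del: One_nat_def)
  also have "(\<Sum>j\<in>?I. \<Sum>i\<in>?I. \<iota> i (gen j \<^bold>\<and> \<beta>) \<otimes> acts (act v (X j)) (\<theta> i)) =
      \<beta> \<otimes> (\<Sum>i\<in>?I. acts (act v (X i)) (\<theta> i))
      - (\<Sum>j\<in>?I. \<Sum>i\<in>?I. (gen j \<^bold>\<and> \<iota> i \<beta>) \<otimes> acts (act v (X j)) (\<theta> i))"
  proof -
    have "\<iota> i (gen j \<^bold>\<and> \<beta>) \<otimes> w = (if j = i then \<beta> \<otimes> w else 0) - (gen j \<^bold>\<and> \<iota> i \<beta>) \<otimes> w"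
      if "i \<in> ?I" "j \<in> ?I" for i j w
      using contract_basis_gen_wedge[OF that b] by (simp add: tensor_diff_left tensor_zero_left tensor_minus_left)
    then show ?thesis by (simp add: sum_subtractf tensor_sum_right del: One_nat_def)
  qed
  also have "(\<Sum>i\<in>?I. \<Sum>j\<in>?I. (gen j \<^bold>\<and> \<iota> i \<beta>) \<otimes> act (acts v (\<theta> i)) (X j)) =
      (\<Sum>j\<in>?I. \<Sum>t\<in>?I. (gen j \<^bold>\<and> \<iota> t \<beta>) \<otimes> act (acts v (\<theta> t)) (X j))"
    by (rule sum.swap)
  finally have "D (D (\<beta> \<otimes> v)) = (\<Sum>i\<in>?I. (d (\<iota> i \<beta>) + \<iota> i (d \<beta>)) \<otimes> acts v (\<theta> i))
      - (\<Sum>j\<in>?I. \<Sum>t\<in>?I. (gen j \<^bold>\<and> \<iota> t \<beta>) \<otimes> act (acts v (\<theta> t)) (X j))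
      + (\<Sum>j\<in>?I. \<Sum>t\<in>?I. (gen j \<^bold>\<and> \<iota> t \<beta>) \<otimes> acts (act v (X j)) (\<theta> t))
      - \<beta> \<otimes> (\<Sum>i\<in>?I. acts (act v (X i)) (\<theta> i))"
    by (simp add: tensor_add_left sum.distrib)
  \<comment> \<open>By Cartan's formula the terms containing \<open>d\<close> give the coadjoint action.\<close>
  moreover have "(\<Sum>i\<in>?I. (d (\<iota> i \<beta>) + \<iota> i (d \<beta>)) \<otimes> acts v (\<theta> i)) =
      - (\<Sum>j\<in>?I. \<Sum>t\<in>?I. (gen j \<^bold>\<and> \<iota> t \<beta>) \<otimes> acts v (coad br (X j) (\<theta> t)))"
  proof -
    have "(\<Sum>i\<in>?I. (d (\<iota> i \<beta>) + \<iota> i (d \<beta>)) \<otimes> acts v (\<theta> i)) =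
        (\<Sum>i\<in>?I. \<Sum>t\<in>?I. \<Sum>j\<in>?I. (gen j \<^bold>\<and> \<iota> t \<beta>) \<otimes> sv (C t j i) (acts v (\<theta> i)))"
    proof (intro sum.cong refl)
      fix i assume i: "i \<in> ?I"
      have "- C t i j = C t j i" if "t \<in> ?I" for t j using C_antisym[OF that, of i j] by simp
      then show "(d (\<iota> i \<beta>) + \<iota> i (d \<beta>)) \<otimes> acts v (\<theta> i) =
          (\<Sum>t\<in>?I. \<Sum>j\<in>?I. (gen j \<^bold>\<and> \<iota> t \<beta>) \<otimes> sv (C t j i) (acts v (\<theta> i)))"
        unfolding cartan[OF i b]
        by (simp add: contract_d_gen[OF i] wedge_sum_left wedge_escale_left tensor_sum_left tensor_escale
            del: One_nat_def)
    qed
    also have "\<dots> = (\<Sum>j\<in>?I. \<Sum>t\<in>?I. \<Sum>i\<in>?I. (gen j \<^bold>\<and> \<iota> t \<beta>) \<otimes> sv (C t j i) (acts v (\<theta> i)))"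
      by (rule trans[OF sum3_cyclic], rule sum.cong[OF refl], rule sum.swap)
    also have "\<dots> = - (\<Sum>j\<in>?I. \<Sum>t\<in>?I. (gen j \<^bold>\<and> \<iota> t \<beta>) \<otimes> acts v (coad br (X j) (\<theta> t)))"
      unfolding sum_negf[symmetric]
      by (intro sum.cong refl) (simp add: acts_coad tensor_sum_right tensor_minus_right del: One_nat_def)
    finally show ?thesis .
  qed
  ultimately show ?thesis
    by (simp add: defect_def tensor_diff_right tensor_add_right sum_subtractf sum.distrib)
qed

lemma tensor_mono_form_eval: "(mono_form S \<otimes> v) T = (if T = S then v else 0)"
  by (simp add: tensor_def mono_form_def)

lemma D_D_zero_iff:
  "(\<forall>w\<in>W N. D (D w) = 0) \<longleftrightarrow>
    (\<forall>v. \<forall>j\<in>{1..N}. \<forall>t\<in>{1..N}. defect j t v = 0) \<and> unimodular_stable N X \<theta> act acts"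
proof (intro iffI conjI)
  assume *: "\<forall>w\<in>W N. D (D w) = 0"
  have uni: "(\<Sum>i=1..N. acts (act v (X i)) (\<theta> i)) = 0" for v
  proof -
    \<comment> \<open>All contractions of \<open>1\<close> vanish, so only the unimodularity term survives.\<close>
    let ?U = "\<Sum>i=1..N. acts (act v (X i)) (\<theta> i)"
    have "0 = D (D (mono_form {} \<otimes> v))" using * tensor_W[OF unit_W(1)] by simp
    also have "\<dots> = - (mono_form {} \<otimes> ?U)"
      unfolding D_D_tensor[OF unit_W(1)] by (simp add: contract_unit wedge_zero_right tensor_zero_left)
    finally have "(mono_form {} \<otimes> ?U) {} = 0" by (simp add: pointwise)
    then show ?thesis by (simp add: tensor_mono_form_eval)
  qed
  then show "unimodular_stable N X \<theta> act acts" by (simp add: unimodular_stable_def)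
  show "\<forall>v. \<forall>j\<in>{1..N}. \<forall>t\<in>{1..N}. defect j t v = 0"
  proof (intro allI ballI)
    \<comment> \<open>Applied to \<open>\<theta>_s\<close>, the double sum reduces to \<open>t = s\<close>, and the coefficient of \<open>\<theta>_j\<close> is read off.\<close>
    fix v j s assume j: "j \<in> {1..N}" and s: "s \<in> {1..N}"
    have "0 = D (D (gen s \<otimes> v))" using * tensor_W[OF gen_W(1)[OF s]] by simp
    also have "\<dots> = - (\<Sum>j=1..N. \<Sum>t=1..N. (gen j \<^bold>\<and> \<iota> t (gen s)) \<otimes> defect j t v)"
      unfolding D_D_tensor[OF gen_W(1)[OF s]] uni by (simp add: tensor_zero_right)
    also have "(\<Sum>j=1..N. \<Sum>t=1..N. (gen j \<^bold>\<and> \<iota> t (gen s)) \<otimes> defect j t v) = (\<Sum>j=1..N. gen j \<otimes> defect j s v)"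
    proof (intro sum.cong refl)
      fix j assume j: "j \<in> {1..N}"
      have "(gen j \<^bold>\<and> \<iota> t (gen s)) \<otimes> w = (if t = s then gen j \<otimes> w else 0)" if "t \<in> {1..N}" for t w
        using contract_gen[OF s, of \<theta> "X t"] dual_pairing[OF s that]
        by (auto simp: escale_one escale_null wedge_zero_right tensor_zero_left wedge_unit[OF gen_W(1)[OF j]])
      then show "(\<Sum>t=1..N. (gen j \<^bold>\<and> \<iota> t (gen s)) \<otimes> defect j t v) = gen j \<otimes> defect j s v"
        using s by (simp del: One_nat_def)
    qed
    finally have z: "(\<Sum>i=1..N. gen i \<otimes> defect i s v) = 0" by simp
    have "(\<Sum>i=1..N. gen i \<otimes> defect i s v) {j} = 0" unfolding z by (rule zero_fun_apply)
    then show "defect j s v = 0"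
      using j by (simp add: sum_fun_apply tensor_mono_form_eval del: One_nat_def)
  qed
next
  assume *: "(\<forall>v. \<forall>j\<in>{1..N}. \<forall>t\<in>{1..N}. defect j t v = 0) \<and> unimodular_stable N X \<theta> act acts"
  have "D (D (\<beta> \<otimes> v)) = 0" if "\<beta> \<in> W N" for \<beta> v
    unfolding D_D_tensor[OF that] using *
    by (simp add: unimodular_stable_def tensor_zero_right del: One_nat_def)
  then have "D (D (\<Sum>S\<in>Pow {1..N}. mono_form S \<otimes> w S)) = 0" for w
    unfolding D_linear(3) by (intro sum.neutral ballI) (auto intro: mono_form_W(1) simp del: One_nat_def)
  then show "\<forall>w\<in>W N. D (D w) = 0" using tensor_expansion by metis
qed

end

theorem proposition3p6:
  fixes sg :: "complex \<Rightarrow> 'g::ab_group_add \<Rightarrow> 'g" and br :: "'g \<Rightarrow> 'g \<Rightarrow> 'g"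
    and N :: nat and X :: "nat \<Rightarrow> 'g" and \<theta> :: "nat \<Rightarrow> 'g \<Rightarrow> complex"
    and sv :: "complex \<Rightarrow> 'v::ab_group_add \<Rightarrow> 'v" and act :: "'v \<Rightarrow> 'g \<Rightarrow> 'v"
    and acts :: "'v \<Rightarrow> ('g \<Rightarrow> complex) \<Rightarrow> 'v"
  assumes "complex_lie_algebra sg br"
    and "dual_bases sg N X \<theta>"
    and "right_lie_module UNIV sg br sv act"
    and "right_sym_module sg sv acts"
  shows "(\<forall>w\<in>W N. d_total br N X \<theta> sv act acts (d_total br N X \<theta> sv act acts w) = 0) \<longleftrightarrow>
    right_sd_module sg br sv act acts \<and> unimodular_stable N X \<theta> act acts"
proof -
  interpret lie_sym_bimodule sg br N X \<theta> sv act acts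
    using assms by (simp add: lie_sym_bimodule_def lie_algebra_basis_def lie_sym_bimodule_axioms_def)
  show ?thesis
    unfolding D_D_zero_iff right_sd_module_iff[OF assms] defect_def right_minus_eq by metis
qed

end
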